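(* Let $G$ be a finite simple graph with maximum degree $\Delta > 1$. Then the acyclic edge chromatic number $a'(G)$ of $G$ satisfies $$a'(G)\le 3.569\,(\Delta-1).$$
   Context: For $N\in\mathbb{N}$ let $[N]=\{1,\dots,N\}$. An edge coloring of $G=(V,E)$ with $N$ colors is a function $c:E\to[N]$. It is proper if no two adjacent edges (edges sharing an endpoint) receive the same color. A proper edge coloring is acyclic if the edges of every cycle of $G$ receive at least three different colors. The acyclic edge chromatic number (also called acyclic edge chromatic index) $a'(G)$ is the minimum $N$ such that $G$ has an acyclic proper edge coloring with $N$ colors. *)

theory Defs
  imports Complex_Main "HOL-Library.FuncSet"
begin

definition finite_simple_graph :: "'a set \<Rightarrow> 'a set set \<Rightarrow> bool" where
  "finite_simple_graph V E \<longleftrightarrow> finite V \<and> (\<forall>e\<in>E. e \<subseteq> V \<and> card e = 2)"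

definition vertex_degree :: "'a set set \<Rightarrow> 'a \<Rightarrow> nat" where
  "vertex_degree E v = card {e \<in> E. v \<in> e}"

text \<open>The inserted \<open>0\<close> only matters for the graph without vertices.\<close>

definition max_degree :: "'a set \<Rightarrow> 'a set set \<Rightarrow> nat" where
  "max_degree V E = Max (insert 0 (vertex_degree E ` V))"

definition edge_coloring :: "'a set set \<Rightarrow> nat \<Rightarrow> ('a set \<Rightarrow> nat) \<Rightarrow> bool" where
  "edge_coloring E N c \<longleftrightarrow> c \<in> E \<rightarrow> {1..N}"

definition proper_edge_coloring :: "'a set set \<Rightarrow> nat \<Rightarrow> ('a set \<Rightarrow> nat) \<Rightarrow> bool" where
  "proper_edge_coloring E N c \<longleftrightarrow>
     edge_coloring E N c \<and> (\<forall>e\<in>E. \<forall>f\<in>E. e \<noteq> f \<and> e \<inter> f \<noteq> {} \<longrightarrow> c e \<noteq> c f)"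

text \<open>A cycle is given by the list of its vertices in cyclic order.\<close>

definition cycle_edges :: "'a list \<Rightarrow> 'a set set" where
  "cycle_edges p = (\<lambda>i. {p ! i, p ! (Suc i mod length p)}) ` {..<length p}"

definition is_cycle :: "'a set set \<Rightarrow> 'a list \<Rightarrow> bool" where
  "is_cycle E p \<longleftrightarrow> 3 \<le> length p \<and> distinct p \<and> cycle_edges p \<subseteq> E"

definition acyclic_edge_coloring :: "'a set set \<Rightarrow> nat \<Rightarrow> ('a set \<Rightarrow> nat) \<Rightarrow> bool" where
  "acyclic_edge_coloring E N c \<longleftrightarrow>
     proper_edge_coloring E N c \<and> (\<forall>p. is_cycle E p \<longrightarrow> 3 \<le> card (c ` cycle_edges p))"

definition acyclic_chromatic_index :: "'a set set \<Rightarrow> nat" where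
  "acyclic_chromatic_index E = (LEAST N. \<exists>c. acyclic_edge_coloring E N c)"

lemma finite_simple_graph_finite_edges:
  assumes "finite_simple_graph V E"
  shows "finite E"
  using assms unfolding finite_simple_graph_def
  by (metis Pow_iff finite_Pow_iff finite_subset subsetI)

lemma three_le_card_cycle_edges:
  assumes "3 \<le> length p" "distinct p"
  shows "3 \<le> card (cycle_edges p)"
proof -
  define e where "e i = {p ! i, p ! (Suc i mod length p)}" for i
  have nth_neq: "p ! i \<noteq> p ! j" if "i < length p" "j < length p" "i \<noteq> j" for i j
    using that assms by (simp add: nth_eq_iff_index_eq)
  have neq: "p ! 0 \<noteq> p ! 1" "p ! 0 \<noteq> p ! 2" "p ! 1 \<noteq> p ! 2"
    using assms nth_neq[of 0 1] nth_neq[of 0 2] nth_neq[of 1 2] by (auto simp flip: length_greater_0_conv)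
  have eq: "e 0 = {p ! 0, p ! 1}" "e 1 = {p ! 1, p ! 2}"
    using assms by (auto simp: e_def numeral_2_eq_2)
  have "Suc 2 mod length p \<noteq> 1 \<and> Suc 2 mod length p < length p"
  proof (cases "length p = 3")
    case False
    then have "Suc 2 < length p" using assms by simp
    then show ?thesis by simp
  qed simp
  then have "p ! 1 \<noteq> p ! (Suc 2 mod length p)"
    using assms by (intro nth_neq) auto
  then have "p ! 1 \<notin> e 2" "p ! 2 \<in> e 2"
    using neq by (auto simp: e_def)
  then have "e 0 \<noteq> e 1" "e 2 \<noteq> e 0" "e 2 \<noteq> e 1"
    using neq unfolding eq by auto
  then have "card {e 0, e 1, e 2} = 3" by auto
  moreover have "{e 0, e 1, e 2} \<subseteq> cycle_edges p"
    using assms by (auto simp: cycle_edges_def e_def simp flip: length_greater_0_conv)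
  moreover have "finite (cycle_edges p)" by (simp add: cycle_edges_def)
  ultimately show ?thesis by (metis card_mono)
qed

lemma acyclic_edge_coloring_exists:
  assumes "finite_simple_graph V E"
  shows "\<exists>N c. acyclic_edge_coloring E N c"
proof -
  obtain c where c: "bij_betw c E {1..card E}"
    using finite_simple_graph_finite_edges[OF assms] ex_bij_betw_nat_finite_1
      bij_betw_inv by blast
  have inj: "inj_on c E" using c by (rule bij_betw_imp_inj_on)
  have "acyclic_edge_coloring E (card E) c"
    unfolding acyclic_edge_coloring_def
  proof (intro conjI allI impI)
    show "proper_edge_coloring E (card E) c"
      using bij_betw_imp_surj_on[OF c] inj
      by (auto simp: proper_edge_coloring_def edge_coloring_def dest: inj_onD)
  next
    fix p assume p: "is_cycle E p"
    then have "card (c ` cycle_edges p) = card (cycle_edges p)"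
      using inj by (metis is_cycle_def card_image inj_on_subset)
    then show "3 \<le> card (c ` cycle_edges p)"
      using p three_le_card_cycle_edges by (metis is_cycle_def)
  qed
  then show ?thesis by blast
qed

lemma acyclic_chromatic_index_attained:
  assumes "finite_simple_graph V E"
  shows "\<exists>c. acyclic_edge_coloring E (acyclic_chromatic_index E) c"
  unfolding acyclic_chromatic_index_def
  by (rule LeastI_ex[OF acyclic_edge_coloring_exists[OF assms]])

end

theory Submission
  imports Defs "HOL-Library.Z2"
begin

text \<open>
  Put \<open>D = \<Delta> - 1\<close>. Every acyclic colouring of \<open>G - u\<close> extends to \<open>G\<close>, so the theorem follows by
  induction on the number of edges. Consider the conflict graph whose vertices are the pairs \<open>(x, \<alpha>)\<close> with
  \<open>x\<close> a neighbour of \<open>u\<close> and \<open>\<alpha>\<close> a colour missing at \<open>x\<close>; an extension is an independent set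
  meeting each part \<open>{x} \<times> _\<close> once. There are two kinds of conflicts: \<open>(x, \<alpha>), (y, \<alpha>)\<close>, and
  \<open>(x, \<alpha>), (y, \<beta>)\<close> when an \<open>\<alpha>\<beta>\<close>-path joins \<open>x\<close> to \<open>y\<close>. As such a path is determined by its
  start and its two colours, each vertex has at most \<open>D\<close> conflicts of the second kind, and
  the vertices of colour \<open>\<alpha>\<close> have together at most \<open>D k\<close> of them, where \<open>k\<close> neighbours of \<open>u\<close>
  see \<open>\<alpha>\<close>. It follows that every subgraph of the conflict graph has an edge whose ends have at most
  \<open>(5 D + 1) / 2\<close> neighbours altogether. By the topological Hall theorem combined with Meshulam's
  inequality (both of them proved here with explicit chains modulo 2) an independent transversal exists
  once the parts have about \<open>(5/2) D\<close> elements, that is, for about \<open>(7/2) D\<close> colours.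
\<close>

section \<open>Chains modulo two on independence complexes\<close>

declare add_bit_eq_xor [simp del] mult_bit_eq_and [simp del] bit_not_zero_iff [simp del]
  bit_not_one_iff [simp del]

lemma bit_add_self [simp]: "x + x = (0::bit)"
  by (cases x) simp_all

lemma bit_add_left_cancel [simp]: "x + (x + y) = (y::bit)"
  by (simp flip: add.assoc)

lemma bit_add_eq_0_iff: "x + y = 0 \<longleftrightarrow> x = (y::bit)"
  by (cases x; cases y) simp_all

type_synonym 'v chain = "'v set \<Rightarrow> bit"

text \<open>The simplicial boundary modulo 2, read off at cofaces. The empty set counts as a face,
  so this is the augmented complex.\<close>

definition boundary :: "'v set \<Rightarrow> 'v chain \<Rightarrow> 'v chain" where
  "boundary W z \<tau> = (\<Sum>v\<in>W - \<tau>. z (insert v \<tau>))"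

text \<open>The join with the point \<open>a\<close>; the part of \<open>t\<close> on sets that
  already contain \<open>a\<close> is discarded.\<close>

definition cone :: "'v \<Rightarrow> 'v chain \<Rightarrow> 'v chain" where
  "cone a t \<sigma> = (if a \<in> \<sigma> then t (\<sigma> - {a}) else 0)"

definition indep :: "'v set set \<Rightarrow> 'v set \<Rightarrow> bool" where
  "indep F \<sigma> \<longleftrightarrow> (\<forall>e\<in>F. \<not> e \<subseteq> \<sigma>)"

definition is_chain :: "'v set set \<Rightarrow> 'v set \<Rightarrow> nat \<Rightarrow> 'v chain \<Rightarrow> bool" where
  "is_chain F V k z \<longleftrightarrow> (\<forall>\<sigma>. z \<sigma> \<noteq> 0 \<longrightarrow> \<sigma> \<subseteq> V \<and> card \<sigma> = k \<and> indep F \<sigma>)"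

text \<open>
  Chains are graded by cardinality, so \<open>k = 0\<close> is the empty simplex and \<open>bounds_below W F V m\<close> says
  that the reduced homology modulo 2 of the independence complex vanishes in dimensions up to \<open>m - 2\<close>.
  The set \<open>W\<close> is an ambient vertex set that stays fixed while \<open>V\<close> shrinks.
\<close>

definition bounds_below :: "'v set \<Rightarrow> 'v set set \<Rightarrow> 'v set \<Rightarrow> nat \<Rightarrow> bool" where
  "bounds_below W F V m \<longleftrightarrow>
     (\<forall>k<m. \<forall>z. is_chain F V k z \<and> boundary W z = (\<lambda>_. 0) \<longrightarrow>
        (\<exists>w. is_chain F V (Suc k) w \<and> boundary W w = z))"

lemma is_chainD:
  assumes "is_chain F V k z" "z \<sigma> \<noteq> 0"
  shows "\<sigma> \<subseteq> V" "card \<sigma> = k" "indep F \<sigma>"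
  using assms by (auto simp: is_chain_def)

lemma indepD: "indep F \<sigma> \<Longrightarrow> e \<in> F \<Longrightarrow> \<not> e \<subseteq> \<sigma>"
  by (simp add: indep_def)

lemma indep_mono: "indep F \<sigma> \<Longrightarrow> F' \<subseteq> F \<Longrightarrow> \<sigma>' \<subseteq> \<sigma> \<Longrightarrow> indep F' \<sigma>'"
  unfolding indep_def by (meson subset_iff subset_trans)

lemma is_chain_add:
  assumes "is_chain F V k y" "is_chain F V k z"
  shows "is_chain F V k (\<lambda>\<sigma>. y \<sigma> + z \<sigma>)"
  using assms unfolding is_chain_def by (metis add_0)

lemma boundary_add: "boundary W (\<lambda>\<sigma>. y \<sigma> + z \<sigma>) = (\<lambda>\<tau>. boundary W y \<tau> + boundary W z \<tau>)"
  by (simp add: boundary_def fun_eq_iff sum.distrib)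

text \<open>Removing \<open>a\<close> from a simplex of the join gives back \<open>t\<close>;
  removing another vertex gives the join over the boundary. The explicit fillings below rest on this
  formula.\<close>

lemma boundary_cone:
  assumes "finite W" "a \<in> W" and t: "\<And>\<sigma>. a \<in> \<sigma> \<Longrightarrow> t \<sigma> = 0"
  shows "boundary W (cone a t) = (\<lambda>\<tau>. t \<tau> + cone a (boundary W t) \<tau>)"
proof
  fix \<tau>
  show "boundary W (cone a t) \<tau> = t \<tau> + cone a (boundary W t) \<tau>"
  proof (cases "a \<in> \<tau>")
    case False
    have "boundary W (cone a t) \<tau> = (\<Sum>v\<in>W - \<tau>. if v = a then t \<tau> else 0)"
      unfolding boundary_def using False by (intro sum.cong) (auto simp: cone_def)
    also have "\<dots> = t \<tau>" using False assms by simp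
    finally show ?thesis using False by (simp add: cone_def)
  next
    case True
    have "boundary W (cone a t) \<tau> = (\<Sum>v\<in>W - \<tau>. t (insert v (\<tau> - {a})))"
      unfolding boundary_def using True
      by (intro sum.cong) (auto simp: cone_def insert_Diff_if)
    \<comment> \<open>The only new index is \<open>a\<close>, where \<open>t\<close>
      vanishes.\<close>
    also have "\<dots> = (\<Sum>v\<in>W - (\<tau> - {a}). t (insert v (\<tau> - {a})))"
    proof (rule sum.mono_neutral_left)
      show "finite (W - (\<tau> - {a}))" using assms by simp
      show "\<forall>v\<in>W - (\<tau> - {a}) - (W - \<tau>). t (insert v (\<tau> - {a})) = 0"
        using t by auto
    qed auto
    finally show ?thesis using True t[of \<tau>] by (simp add: cone_def boundary_def)
  qed
qed

text \<open>Without edges the complex is a full simplex: the cone from \<open>a\<close> over the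
  part of a cycle that avoids \<open>a\<close> fills the cycle.\<close>

lemma bounds_below_edgeless:
  assumes "finite W" "V \<subseteq> W" "a \<in> V"
  shows "bounds_below W {} V m"
  unfolding bounds_below_def
proof (intro allI impI, elim conjE)
  fix k z
  assume z: "is_chain {} V k z" and z0: "boundary W z = (\<lambda>_. 0)"
  define t where "t = (\<lambda>\<sigma>. if a \<in> \<sigma> then 0 else z \<sigma>)"
  define z1 where "z1 = (\<lambda>\<sigma>. if a \<in> \<sigma> then 0 else z (insert a \<sigma>))"
  have fin: "finite V" using assms finite_subset by blast
  have aW: "a \<in> W" using assms by blast
  have z_eq: "z = (\<lambda>\<sigma>. t \<sigma> + cone a z1 \<sigma>)"
    unfolding t_def z1_def cone_def by (auto simp: fun_eq_iff insert_absorb)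
  have "boundary W (\<lambda>\<sigma>. t \<sigma> + cone a z1 \<sigma>) =
      (\<lambda>\<tau>. boundary W t \<tau> + (z1 \<tau> + cone a (boundary W z1) \<tau>))"
    by (subst boundary_add, subst boundary_cone[OF assms(1) aW]) (auto simp: z1_def)
  then have *: "boundary W t \<tau> + (z1 \<tau> + cone a (boundary W z1) \<tau>) = 0" for \<tau>
    using z0 unfolding z_eq[symmetric] by (metis (full_types))
  \<comment> \<open>As \<open>z\<close> is a cycle, comparing coefficients at faces that avoid
    \<open>a\<close> ties the part off \<open>a\<close> to the link of \<open>a\<close>.\<close>
  have bt: "boundary W t \<tau> = z1 \<tau>" for \<tau>
  proof (cases "a \<in> \<tau>")
    case True
    then have "boundary W t \<tau> = 0" by (simp add: boundary_def t_def)
    with True show ?thesis by (simp add: z1_def)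
  next
    case False
    with *[of \<tau>] show ?thesis by (simp add: cone_def bit_add_eq_0_iff)
  qed
  have "boundary W (cone a t) = (\<lambda>\<tau>. t \<tau> + cone a (boundary W t) \<tau>)"
    by (rule boundary_cone[OF assms(1) aW]) (simp add: t_def)
  also have "boundary W t = z1" using bt by auto
  finally have "boundary W (cone a t) = z" unfolding z_eq[symmetric] .
  moreover have "is_chain {} V (Suc k) (cone a t)"
    unfolding is_chain_def
  proof (intro allI impI)
    fix \<sigma> assume "cone a t \<sigma> \<noteq> 0"
    then have a: "a \<in> \<sigma>" and "z (\<sigma> - {a}) \<noteq> 0" by (auto simp: cone_def t_def split: if_splits)
    then have "\<sigma> - {a} \<subseteq> V" "card (\<sigma> - {a}) = k" using is_chainD[OF z] by auto
    moreover then have "finite \<sigma>" using fin by (meson finite_Diff2 finite_subset finite.intros)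
    ultimately have "card \<sigma> = Suc k" "\<sigma> \<subseteq> V"
      using a assms(3) card_Suc_Diff1[of \<sigma> a] by (metis, blast)
    then show "\<sigma> \<subseteq> V \<and> card \<sigma> = Suc k \<and> indep {} \<sigma>" by (simp add: indep_def)
  qed
  ultimately show "\<exists>w. is_chain {} V (Suc k) w \<and> boundary W w = z" by blast
qed

section \<open>Deleting and exploding edges\<close>

definition nbrs :: "'v set set \<Rightarrow> 'v \<Rightarrow> 'v set" where
  "nbrs F a = {x. {a, x} \<in> F}"

lemma nbrs_mono: "F \<subseteq> F' \<Longrightarrow> nbrs F v \<subseteq> nbrs F' v"
  by (auto simp: nbrs_def)

text \<open>
  Meshulam's inequality: deleting an edge and exploding it (removing the neighbourhoods of both
  ends) together control the independence complex. Fill a cycle after deleting \<open>ab\<close>; the simplices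
  through both \<open>a\<close> and \<open>b\<close> form a join \<open>ab * u\<close> with \<open>u\<close> a cycle of the exploded graph, and if \<open>t\<close>
  fills \<open>u\<close> there, \<open>a * t + b * t\<close> may replace that join.
\<close>

lemma bounds_below_explode:
  assumes W: "finite W" "V \<subseteq> W"
    and F: "\<And>e. e \<in> F \<Longrightarrow> e \<subseteq> V \<and> card e = 2"
    and ab: "{a, b} \<in> F"
    and del: "bounds_below W (F - {{a, b}}) V m"
    and V': "V' = V - (nbrs F a \<union> nbrs F b)"
    and expl: "bounds_below W {e \<in> F. e \<subseteq> V'} V' (m - 1)"
  shows "bounds_below W F V m"
  unfolding bounds_below_def
proof (intro allI impI, elim conjE)
  fix k z
  assume km: "k < m" and z: "is_chain F V k z" and z0: "boundary W z = (\<lambda>_. 0)"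
  let ?e = "{a, b}"
  have fin: "finite V" using W finite_subset by blast
  have aV: "a \<in> V" "b \<in> V" "a \<in> W" "b \<in> W" and neq: "a \<noteq> b"
    using F[OF ab] W by (auto simp: card_insert_if split: if_splits)
  have "is_chain (F - {?e}) V k z" using z by (auto simp: is_chain_def indep_def)
  then obtain w where w: "is_chain (F - {?e}) V (Suc k) w" and bw: "boundary W w = z"
    using del km z0 by (auto simp: bounds_below_def)
  show "\<exists>w. is_chain F V (Suc k) w \<and> boundary W w = z"
  proof (cases k)
    \<comment> \<open>Here the simplices of \<open>w\<close> are single vertices, too small to
      contain \<open>?e\<close>, so \<open>w\<close> itself will do.\<close>
    case 0
    have "is_chain F V (Suc k) w" unfolding is_chain_def
    proof (intro allI impI)
      fix \<sigma> assume s: "w \<sigma> \<noteq> 0"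
      note d = is_chainD[OF w s]
      have "\<not> ?e \<subseteq> \<sigma>"
        using d(1,2) 0 neq fin finite_subset card_mono[of \<sigma> ?e] by fastforce
      then show "\<sigma> \<subseteq> V \<and> card \<sigma> = Suc k \<and> indep F \<sigma>" using d by (auto simp: indep_def)
    qed
    then show ?thesis using bw by blast
  next
    case (Suc l)
    \<comment> \<open>\<open>u\<close> is the link of the edge \<open>ab\<close> in
      \<open>w\<close>; \<open>w0\<close> is \<open>w\<close> without the simplices through both
      ends.\<close>
    define u where "u = (\<lambda>\<sigma>. if a \<in> \<sigma> \<or> b \<in> \<sigma> then 0 else w (insert a (insert b \<sigma>)))"
    define w0 where "w0 = (\<lambda>\<sigma>. if a \<in> \<sigma> \<and> b \<in> \<sigma> then 0 else w \<sigma>)"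
    define F' where "F' = {e \<in> F. e \<subseteq> V'}"
    have ua: "a \<in> \<sigma> \<Longrightarrow> u \<sigma> = 0" and ub: "b \<in> \<sigma> \<Longrightarrow> u \<sigma> = 0" for \<sigma> by (auto simp: u_def)
    have cone_b: "boundary W (cone b t) = (\<lambda>\<tau>. t \<tau> + cone b (boundary W t) \<tau>)"
      if "\<And>\<sigma>. b \<in> \<sigma> \<Longrightarrow> t \<sigma> = 0" for t
      using boundary_cone[OF W(1) aV(4) that] .
    have cone_a: "boundary W (cone a t) = (\<lambda>\<tau>. t \<tau> + cone a (boundary W t) \<tau>)"
      if "\<And>\<sigma>. a \<in> \<sigma> \<Longrightarrow> t \<sigma> = 0" for t
      using boundary_cone[OF W(1) aV(3) that] .
    have w_eq: "w = (\<lambda>\<sigma>. w0 \<sigma> + cone a (cone b u) \<sigma>)"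
    proof
      fix \<sigma>
      have "a \<in> \<sigma> \<Longrightarrow> b \<in> \<sigma> \<Longrightarrow> insert a (insert b (\<sigma> - {a} - {b})) = \<sigma>" by auto
      then show "w \<sigma> = w0 \<sigma> + cone a (cone b u) \<sigma>"
        using neq by (auto simp: w0_def cone_def u_def)
    qed
    have z_eq: "z \<tau> = boundary W w0 \<tau> + (cone b u \<tau> + cone a (\<lambda>\<tau>. u \<tau> + cone b (boundary W u) \<tau>) \<tau>)" for \<tau>
    proof -
      have "boundary W (cone a (cone b u)) \<tau> = cone b u \<tau> + cone a (boundary W (cone b u)) \<tau>"
        by (subst cone_a) (use neq in \<open>auto simp: cone_def ua\<close>)
      also have "boundary W (cone b u) = (\<lambda>\<tau>. u \<tau> + cone b (boundary W u) \<tau>)"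
        using cone_b ub by blast
      finally have "boundary W (\<lambda>\<sigma>. w0 \<sigma> + cone a (cone b u) \<sigma>) \<tau> = boundary W w0 \<tau> +
          (cone b u \<tau> + cone a (\<lambda>\<tau>. u \<tau> + cone b (boundary W u) \<tau>) \<tau>)"
        by (simp only: boundary_add)
      then show ?thesis unfolding w_eq[symmetric] bw .
    qed
    \<comment> \<open>On simplices through both ends \<open>z\<close> vanishes, being a chain for
      \<open>F\<close>; comparing coefficients there leaves only the boundary of
      \<open>u\<close>.\<close>
    have bu: "boundary W u \<sigma> = 0" for \<sigma>
    proof (cases "a \<in> \<sigma> \<or> b \<in> \<sigma>")
      case True
      then show ?thesis by (auto simp: boundary_def ua ub intro!: sum.neutral)
    next
      case False
      let ?s = "insert a (insert b \<sigma>)"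
      have "z ?s = 0"
      proof (rule ccontr)
        assume "z ?s \<noteq> 0"
        from indepD[OF is_chainD(3)[OF z this] ab] show False by simp
      qed
      moreover have "boundary W w0 ?s = 0" by (simp add: boundary_def w0_def)
      moreover have "?s - {b} = insert a \<sigma>" "?s - {a} = insert b \<sigma>" "insert b \<sigma> - {b} = \<sigma>"
        using False neq by auto
      ultimately show ?thesis
        using z_eq[of ?s] False neq ua[of "insert a \<sigma>"] ub[of "insert b \<sigma>"] by (simp add: cone_def)
    qed
    have "is_chain F' V' l u"
      unfolding is_chain_def
    proof (intro allI impI)
      fix \<sigma> assume s: "u \<sigma> \<noteq> 0"
      then have nin: "a \<notin> \<sigma>" "b \<notin> \<sigma>" and ws: "w (insert a (insert b \<sigma>)) \<noteq> 0"
        by (auto simp: u_def split: if_splits)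
      note d = is_chainD[OF w ws]
      have "finite \<sigma>" using d(1) fin finite_subset by auto
      then have "card \<sigma> = l" using d(2) nin neq Suc by simp
      \<comment> \<open>Only the edge \<open>ab\<close> was deleted, so all other edges at
        \<open>a\<close> or \<open>b\<close> still restrict the simplices of
        \<open>w\<close>.\<close>
      moreover have "x \<notin> nbrs F a \<union> nbrs F b" if "x \<in> \<sigma>" for x
      proof
        assume "x \<in> nbrs F a \<union> nbrs F b"
        moreover have "{a, x} \<noteq> ?e" "{b, x} \<noteq> ?e" using nin that by (auto simp: doubleton_eq_iff)
        ultimately have "{a, x} \<in> F - {?e} \<or> {b, x} \<in> F - {?e}" by (simp add: nbrs_def)
        then show False using indepD[OF d(3)] that by auto
      qed
      moreover have "indep F' \<sigma>"
      proof (rule indep_mono[OF d(3)])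
        have "?e \<notin> F'" using ab by (simp add: F'_def V' nbrs_def insert_commute)
        then show "F' \<subseteq> F - {?e}" by (auto simp: F'_def)
      qed blast
      ultimately show "\<sigma> \<subseteq> V' \<and> card \<sigma> = l \<and> indep F' \<sigma>" using d(1) V' by auto
    qed
    moreover have "l < m - 1" using km Suc by simp
    moreover have "boundary W u = (\<lambda>_. 0)" using bu by auto
    ultimately obtain t where t: "is_chain F' V' k t" and bt: "boundary W t = u"
      using expl Suc by (auto simp: bounds_below_def F'_def)
    have nV': "a \<notin> V'" "b \<notin> V'" using ab V' by (auto simp: nbrs_def insert_commute)
    have ta: "a \<in> \<sigma> \<Longrightarrow> t \<sigma> = 0" and tb: "b \<in> \<sigma> \<Longrightarrow> t \<sigma> = 0" for \<sigma>
      using is_chainD(1)[OF t, of \<sigma>] nV' by auto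
    \<comment> \<open>No neighbour of \<open>a\<close> or \<open>b\<close> lies in
      \<open>V'\<close>, so joining either vertex keeps simplices independent.\<close>
    have cone_chain: "is_chain F V (Suc k) (cone c t)" if c: "c \<in> {a, b}" for c
      unfolding is_chain_def
    proof (intro allI impI)
      fix \<sigma> assume "cone c t \<sigma> \<noteq> 0"
      then have cs: "c \<in> \<sigma>" and ts: "t (\<sigma> - {c}) \<noteq> 0" by (auto simp: cone_def split: if_splits)
      note d = is_chainD[OF t ts]
      have fs: "finite \<sigma>" using d(1) V' fin
        by (meson Diff_subset finite_Diff2 finite_subset finite.emptyI finite_insert)
      have "\<sigma> \<subseteq> V" using d(1) V' cs c aV by auto
      moreover have "card \<sigma> = Suc k" using card_Suc_Diff1[OF fs cs] unfolding d(2) ..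
      moreover have "indep F \<sigma>" unfolding indep_def
      proof (intro ballI notI)
        fix f assume f: "f \<in> F" "f \<subseteq> \<sigma>"
        show False
        proof (cases "c \<in> f")
          case True
          then obtain x where x: "f = {c, x}" "x \<noteq> c"
            using F[OF f(1)] by (auto simp: card_2_iff)
          then have "x \<in> V'" using d(1) f(2) by auto
          then show False using x f(1) c V' by (auto simp: nbrs_def)
        next
          case False
          then have "f \<subseteq> \<sigma> - {c}" using f by auto
          moreover then have "f \<in> F'" using f(1) d(1) by (auto simp: F'_def)
          ultimately show False using indepD[OF d(3)] by blast
        qed
      qed
      ultimately show "\<sigma> \<subseteq> V \<and> card \<sigma> = Suc k \<and> indep F \<sigma>" by simp
    qed
    have "is_chain F V (Suc k) w0"
      unfolding is_chain_def
    proof (intro allI impI)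
      fix \<sigma> assume "w0 \<sigma> \<noteq> 0"
      then have n: "\<not> ?e \<subseteq> \<sigma>" and ws: "w \<sigma> \<noteq> 0" by (auto simp: w0_def split: if_splits)
      then show "\<sigma> \<subseteq> V \<and> card \<sigma> = Suc k \<and> indep F \<sigma>"
        using is_chainD[OF w ws] unfolding indep_def by (metis Diff_iff empty_iff insert_iff)
    qed
    then have "is_chain F V (Suc k) (\<lambda>\<sigma>. w0 \<sigma> + (cone a t \<sigma> + cone b t \<sigma>))"
      using cone_chain by (intro is_chain_add) auto
    \<comment> \<open>The two copies of \<open>t\<close> cancel. What remains,
      \<open>cone a u\<close> plus \<open>cone b u\<close>, is what the join of \<open>ab\<close>
      with the cycle \<open>u\<close> contributed to the boundary of \<open>w\<close>.\<close>
    moreover have "boundary W (\<lambda>\<sigma>. w0 \<sigma> + (cone a t \<sigma> + cone b t \<sigma>)) = z"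
    proof
      fix \<tau>
      have "boundary W (\<lambda>\<sigma>. w0 \<sigma> + (cone a t \<sigma> + cone b t \<sigma>)) \<tau>
          = boundary W w0 \<tau> + ((t \<tau> + cone a u \<tau>) + (t \<tau> + cone b u \<tau>))"
        using cone_a[OF ta] cone_b[OF tb] bt by (simp add: boundary_add)
      also have "\<dots> = boundary W w0 \<tau> + (cone b u \<tau> + cone a u \<tau>)"
        by (simp add: ac_simps)
      also have "\<dots> = z \<tau>"
        unfolding z_eq using bu by (auto simp: cone_def)
      finally show "boundary W (\<lambda>\<sigma>. w0 \<sigma> + (cone a t \<sigma> + cone b t \<sigma>)) \<tau> = z \<tau>" .
    qed
    ultimately show ?thesis by blast
  qed
qed

text \<open>Induction on the number of edges. Deletion keeps \<open>V\<close> and \<open>m\<close>;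
  an explosion costs one degree and at most \<kappa> vertices, which
  \<open>m * \<kappa> < card V\<close> can afford. So a vertex is left when the edges are used up,
  and a nonempty full simplex bounds in all degrees.\<close>

lemma bounds_below_small_explosions:
  assumes W: "finite W"
    and F0: "\<And>e. e \<in> F0 \<Longrightarrow> e \<subseteq> W \<and> card e = 2"
    and small: "\<And>F. F \<subseteq> F0 \<Longrightarrow> F \<noteq> {} \<Longrightarrow>
      \<exists>a b. {a, b} \<in> F \<and> card (nbrs F a \<union> nbrs F b) \<le> \<kappa>"
    and "F \<subseteq> F0" "V \<subseteq> W" "\<And>e. e \<in> F \<Longrightarrow> e \<subseteq> V" "m * \<kappa> < card V"
  shows "bounds_below W F V (Suc m)"
proof -
  have "finite F0" using W F0 by (meson Pow_iff finite_Pow_iff rev_finite_subset subsetI)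
  then have "finite F" using assms(4) finite_subset by blast
  then show ?thesis using assms(4-)
  proof (induction "card F" arbitrary: F V m rule: less_induct)
    case less
    have finV: "finite V" using W less.prems finite_subset by blast
    show ?case
    proof (cases "F = {}")
      case True
      obtain a where "a \<in> V" using less.prems(5) by fastforce
      then show ?thesis using bounds_below_edgeless W less.prems True by metis
    next
      case False
      then obtain a b where ab: "{a, b} \<in> F" and k: "card (nbrs F a \<union> nbrs F b) \<le> \<kappa>"
        using small less.prems(2) by blast
      define V' where "V' = V - (nbrs F a \<union> nbrs F b)"
      have "bounds_below W (F - {{a, b}}) V (Suc m)"
      proof (rule less.hyps)
        show "card (F - {{a, b}}) < card F" using less.prems(1) ab by (rule card_Diff1_less)
      qed (use less.prems in auto)
      moreover have "bounds_below W {e \<in> F. e \<subseteq> V'} V' m"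
      proof (cases m)
        \<comment> \<open>Nothing has to bound in the exploded graph, where \<open>V'\<close> may
          even be empty.\<close>
        case 0
        then show ?thesis by (simp add: bounds_below_def)
      next
        case (Suc l)
        have "a \<notin> V'" using ab by (auto simp: V'_def nbrs_def insert_commute)
        then have "{a, b} \<notin> {e \<in> F. e \<subseteq> V'}" by simp
        then have "{e \<in> F. e \<subseteq> V'} \<subset> F" using ab by (metis (no_types, lifting) mem_Collect_eq psubsetI subsetI)
        then have c: "card {e \<in> F. e \<subseteq> V'} < card F" using less.prems(1) psubset_card_mono by blast
        have "card V - card (nbrs F a \<union> nbrs F b) \<le> card V'"
          unfolding V'_def
        proof (rule diff_card_le_card_Diff)
          have "nbrs F a \<union> nbrs F b \<subseteq> V" using less.prems(4) by (auto simp: nbrs_def)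
          then show "finite (nbrs F a \<union> nbrs F b)" using finV finite_subset by blast
        qed
        then have "l * \<kappa> < card V'" using less.prems(5) k Suc by simp
        then show ?thesis using less.hyps[OF c, of V' l] less.prems Suc
          by (auto simp: V'_def)
      qed
      ultimately show ?thesis
        using less.prems F0 ab
        by (intro bounds_below_explode[OF W less.prems(3) _ ab _ V'_def]) auto
    qed
  qed
qed

section \<open>Independent transversals\<close>

text \<open>A simplex inside \<open>V\<close> can only contain edges inside \<open>V\<close>. This
  reconciles the explosion argument, whose edges lie in \<open>V\<close>, with one fixed
  \<open>F\<close> for all unions of parts.\<close>

lemma bounds_below_restrict:
  "bounds_below W {e \<in> F. e \<subseteq> V} V m \<longleftrightarrow> bounds_below W F V m"
proof -
  have "is_chain {e \<in> F. e \<subseteq> V} V k z \<longleftrightarrow> is_chain F V k z" for k z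
    unfolding is_chain_def indep_def by (metis (no_types, lifting) mem_Collect_eq subset_trans)
  then show ?thesis by (simp add: bounds_below_def)
qed

lemma boundary_sum: "boundary W (\<lambda>\<sigma>. \<Sum>i\<in>X. g i \<sigma>) \<tau> = (\<Sum>i\<in>X. boundary W (g i) \<tau>)"
  unfolding boundary_def by (rule sum.swap)

text \<open>The terms for \<open>(i, j)\<close> and \<open>(j, i)\<close> cancel modulo 2. Below
  this shows that the prescribed boundaries are cycles.\<close>

lemma sum_off_diagonal_bit:
  assumes "finite X" "\<And>i j. h i j = (h j i :: bit)"
  shows "(\<Sum>i\<in>X. \<Sum>j\<in>X - {i}. h i j) = 0"
  using assms(1)
proof induction
  case (insert x X)
  have "(\<Sum>i\<in>X. \<Sum>j\<in>insert x X - {i}. h i j) = (\<Sum>i\<in>X. h i x + (\<Sum>j\<in>X - {i}. h i j))"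
  proof (rule sum.cong)
    fix i assume "i \<in> X"
    then have "insert x X - {i} = insert x (X - {i})" "x \<notin> X - {i}" using insert by auto
    then show "(\<Sum>j\<in>insert x X - {i}. h i j) = h i x + (\<Sum>j\<in>X - {i}. h i j)"
      using insert by simp
  qed simp
  also have "\<dots> = (\<Sum>i\<in>X. h x i)"
    using insert.IH assms(2)[of _ x] by (simp add: sum.distrib)
  finally show ?case using insert by simp
qed simp

text \<open>A chain map from the simplex on \<open>I\<close> to the independence complex that sends
  a face \<open>X\<close> to a chain on the parts in \<open>X\<close>. It is built by dimension: the
  smaller faces prescribe a cycle as the boundary of \<open>f X\<close>, and \<open>bb\<close> fills
  it. Faces with up to \<open>n\<close> elements have been treated.\<close>

lemma simplex_chains_exist:
  assumes "finite W" "finite I" and noF: "{} \<notin> F"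
    and bb: "\<And>X. X \<subseteq> I \<Longrightarrow> X \<noteq> {} \<Longrightarrow> bounds_below W F {v \<in> W. part v \<in> X} (card X)"
  shows "\<exists>f. f {} = (\<lambda>\<sigma>. if \<sigma> = {} then 1 else 0) \<and>
    (\<forall>X. X \<subseteq> I \<and> X \<noteq> {} \<and> card X \<le> n \<longrightarrow> is_chain F {v \<in> W. part v \<in> X} (card X) (f X) \<and>
      boundary W (f X) = (\<lambda>\<tau>. \<Sum>i\<in>X. f (X - {i}) \<tau>))"
proof (induction n)
  case 0
  have "card X = 0 \<longleftrightarrow> X = {}" if "X \<subseteq> I" for X using that assms(2) finite_subset by fastforce
  then show ?case by (intro exI[of _ "\<lambda>X \<sigma>. if \<sigma> = {} then 1 else 0"]) auto
next
  case (Suc n)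
  then obtain f where f0: "f {} = (\<lambda>\<sigma>. if \<sigma> = {} then 1 else 0)"
    and f: "\<And>X. X \<subseteq> I \<Longrightarrow> X \<noteq> {} \<Longrightarrow> card X \<le> n \<Longrightarrow>
      is_chain F {v \<in> W. part v \<in> X} (card X) (f X) \<and>
      boundary W (f X) = (\<lambda>\<tau>. \<Sum>i\<in>X. f (X - {i}) \<tau>)" by blast
  \<comment> \<open>The formula extends to the empty face, where both sides vanish.\<close>
  have bf: "boundary W (f X) = (\<lambda>\<tau>. \<Sum>i\<in>X. f (X - {i}) \<tau>)" if "X \<subseteq> I" "card X \<le> n" for X
  proof (cases "X = {}")
    case True
    then show ?thesis by (simp add: f0 boundary_def fun_eq_iff)
  qed (use f that in blast)
  have "\<exists>w. is_chain F {v \<in> W. part v \<in> X} (card X) w \<and>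
      boundary W w = (\<lambda>\<tau>. \<Sum>i\<in>X. f (X - {i}) \<tau>)" if X: "X \<subseteq> I" "card X = Suc n" for X
  proof -
    let ?V = "{v \<in> W. part v \<in> X}" and ?z = "\<lambda>\<tau>. \<Sum>i\<in>X. f (X - {i}) \<tau>"
    have fX: "finite X" using X assms finite_subset by blast
    have cX: "card (X - {i}) = n" if "i \<in> X" for i using X that fX by simp
    have "is_chain F ?V n ?z" unfolding is_chain_def
    proof (intro allI impI)
      fix \<sigma> assume "?z \<sigma> \<noteq> 0"
      then obtain i where i: "i \<in> X" and fi: "f (X - {i}) \<sigma> \<noteq> 0" by (meson sum.neutral)
      show "\<sigma> \<subseteq> ?V \<and> card \<sigma> = n \<and> indep F \<sigma>"
      proof (cases "X - {i} = {}")
        case True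
        then have "\<sigma> = {}" using fi f0 by (metis (full_types))
        moreover have "n = 0" using cX[OF i] True by simp
        moreover have "indep F {}" using noF by (auto simp: indep_def)
        ultimately show ?thesis by simp
      next
        case False
        then have "is_chain F {v \<in> W. part v \<in> X - {i}} n (f (X - {i}))"
          using f[of "X - {i}"] X cX[OF i] by auto
        from is_chainD[OF this fi] show ?thesis by auto
      qed
    qed
    \<comment> \<open>Each face of codimension two arises by removing \<open>i\<close> and
      \<open>j\<close> in either order.\<close>
    moreover have "boundary W ?z = (\<lambda>_. 0)"
    proof
      fix \<tau>
      have "boundary W ?z \<tau> = (\<Sum>i\<in>X. \<Sum>j\<in>X - {i}. f (X - {i} - {j}) \<tau>)"
        unfolding boundary_sum
      proof (rule sum.cong)
        fix i assume "i \<in> X"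
        then have "boundary W (f (X - {i})) = (\<lambda>\<tau>. \<Sum>j\<in>X - {i}. f (X - {i} - {j}) \<tau>)"
          using X cX by (intro bf) auto
        then show "boundary W (f (X - {i})) \<tau> = (\<Sum>j\<in>X - {i}. f (X - {i} - {j}) \<tau>)" by simp
      qed simp
      also have "\<dots> = 0"
        by (rule sum_off_diagonal_bit[OF fX]) (simp add: Diff_insert2 [symmetric] insert_commute)
      finally show "boundary W ?z \<tau> = 0" .
    qed
    moreover have "X \<noteq> {}" using X by auto
    ultimately show ?thesis using bb[OF X(1)] X(2) by (auto simp: bounds_below_def)
  qed
  note step = this
  define g where "g = (\<lambda>X. SOME w. is_chain F {v \<in> W. part v \<in> X} (card X) w \<and>
      boundary W w = (\<lambda>\<tau>. \<Sum>i\<in>X. f (X - {i}) \<tau>))"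
  have g: "is_chain F {v \<in> W. part v \<in> X} (card X) (g X) \<and>
      boundary W (g X) = (\<lambda>\<tau>. \<Sum>i\<in>X. f (X - {i}) \<tau>)" if "X \<subseteq> I" "card X = Suc n" for X
    unfolding g_def by (rule someI_ex[OF step[OF that]])
  define f' where "f' = (\<lambda>X. if card X = Suc n then g X else f X)"
  have "is_chain F {v \<in> W. part v \<in> X} (card X) (f' X) \<and>
      boundary W (f' X) = (\<lambda>\<tau>. \<Sum>i\<in>X. f' (X - {i}) \<tau>)"
    if X: "X \<subseteq> I" "X \<noteq> {}" "card X \<le> Suc n" for X
  proof -
    have "finite X" using X assms finite_subset by blast
    then have "card (X - {i}) \<noteq> Suc n" if "i \<in> X" for i
      using X that by (metis Suc_n_not_le_n card_Suc_Diff1)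
    then have "(\<lambda>\<tau>. \<Sum>i\<in>X. f' (X - {i}) \<tau>) = (\<lambda>\<tau>. \<Sum>i\<in>X. f (X - {i}) \<tau>)"
      by (auto simp: f'_def fun_eq_iff intro!: sum.cong)
    then show ?thesis using g[OF X(1)] f[OF X(1,2)] X(3) by (auto simp: f'_def)
  qed
  then show ?case using f0 by (intro exI[of _ f']) (auto simp: f'_def)
qed

text \<open>
  Sperner's parity argument: a set with \<open>|Y|\<close> elements contains exactly one rainbow facet of colours
  \<open>Y - {i}\<close> if it is rainbow itself, and zero or two otherwise.
\<close>

lemma rainbow_coefficient_sum:
  assumes "finite W" "finite X"
    and f0: "f {} = (\<lambda>\<sigma>. if \<sigma> = {} then 1 else 0)"
    and f: "\<And>Y. Y \<subseteq> X \<Longrightarrow> Y \<noteq> {} \<Longrightarrow> is_chain F {v \<in> W. part v \<in> Y} (card Y) (f Y) \<and>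
      boundary W (f Y) = (\<lambda>\<tau>. \<Sum>i\<in>Y. f (Y - {i}) \<tau>)"
  shows "(\<Sum>\<sigma> | \<sigma> \<subseteq> W \<and> bij_betw part \<sigma> X. f X \<sigma>) = 1"
  using assms(2) f
proof (induction X)
  case empty
  have "{\<sigma>. \<sigma> \<subseteq> W \<and> bij_betw part \<sigma> {}} = {{}}" by (auto simp: bij_betw_def)
  then show ?case using f0 by simp
next
  case (insert i X)
  define R where "R = (\<lambda>Y. {\<sigma>. \<sigma> \<subseteq> W \<and> bij_betw part \<sigma> Y})"
  define Y where "Y = insert i X"
  have fR: "finite (R Z)" for Z unfolding R_def using assms(1) by simp
  have Yi: "Y - {i} = X" using insert by (auto simp: Y_def)
  have chY: "is_chain F {v \<in> W. part v \<in> Y} (card Y) (f Y)"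
    and bdY: "boundary W (f Y) = (\<lambda>\<tau>. \<Sum>j\<in>Y. f (Y - {j}) \<tau>)"
    using insert.prems[of Y] by (auto simp: Y_def)
  have finY: "finite Y" using insert by (simp add: Y_def)
  \<comment> \<open>A simplex with all colours of \<open>X\<close> occurs in no
    \<open>f (Y - {j})\<close> with \<open>j\<close> in \<open>X\<close>, so only the facet
    \<open>X\<close> contributes.\<close>
  have "(\<Sum>\<tau>\<in>R X. boundary W (f Y) \<tau>) = (\<Sum>\<tau>\<in>R X. f X \<tau>)"
  proof (rule sum.cong)
    fix \<tau> assume \<tau>: "\<tau> \<in> R X"
    have "f (Y - {j}) \<tau> = 0" if j: "j \<in> X" for j
    proof (rule ccontr)
      assume nz: "f (Y - {j}) \<tau> \<noteq> 0"
      have "i \<in> Y - {j}" using j insert by (auto simp: Y_def)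
      then have "is_chain F {v \<in> W. part v \<in> Y - {j}} (card (Y - {j})) (f (Y - {j}))"
        using insert.prems[of "Y - {j}"] by (auto simp: Y_def)
      from is_chainD(1)[OF this nz] have "j \<notin> part ` \<tau>" by auto
      then show False using \<tau> j by (auto simp: R_def bij_betw_def)
    qed
    then have "(\<Sum>j\<in>X. f (Y - {j}) \<tau>) = 0" by simp
    then show "boundary W (f Y) \<tau> = f X \<tau>"
      using insert.hyps Yi unfolding bdY by (simp add: Y_def)
  qed simp
  also have "\<dots> = 1"
    unfolding R_def using insert.prems by (intro insert.IH) auto
  finally have one: "(\<Sum>\<tau>\<in>R X. boundary W (f Y) \<tau>) = 1" .
  \<comment> \<open>The count is turned around to run over the larger sets \<sigma>;
    \<open>?A \<sigma>\<close> holds the vertices whose removal leaves a rainbow set of colours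
    \<open>X\<close>.\<close>
  let ?A = "\<lambda>\<sigma>. {v \<in> \<sigma>. \<sigma> - {v} \<in> R X}"
  have "(\<Sum>\<tau>\<in>R X. boundary W (f Y) \<tau>)
      = (\<Sum>(\<tau>, v)\<in>(SIGMA \<tau>:R X. W - \<tau>). f Y (insert v \<tau>))"
    unfolding boundary_def using fR assms(1) by (subst sum.Sigma) auto
  also have "\<dots> = (\<Sum>(\<sigma>, v)\<in>(SIGMA \<sigma>:Pow W. ?A \<sigma>). f Y \<sigma>)"
    by (rule sum.reindex_bij_witness[of _ "\<lambda>(\<sigma>, v). (\<sigma> - {v}, v)" "\<lambda>(\<tau>, v). (insert v \<tau>, v)"])
      (auto simp: R_def insert_absorb)
  also have "\<dots> = (\<Sum>\<sigma>\<in>Pow W. \<Sum>v\<in>?A \<sigma>. f Y \<sigma>)"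
    using assms(1) by (subst sum.Sigma) (auto intro: finite_subset)
  also have "\<dots> = (\<Sum>\<sigma>\<in>Pow W. if \<sigma> \<in> R Y then f Y \<sigma> else 0)"
  proof (rule sum.cong)
    fix \<sigma> assume \<sigma>: "\<sigma> \<in> Pow W"
    show "(\<Sum>v\<in>?A \<sigma>. f Y \<sigma>) = (if \<sigma> \<in> R Y then f Y \<sigma> else 0)"
    proof (cases "f Y \<sigma> = 0")
      case False
      note d = is_chainD[OF chY False]
      show ?thesis
      proof (cases "\<sigma> \<in> R Y")
        case True
        then have inj: "inj_on part \<sigma>" and im: "part ` \<sigma> = Y" by (auto simp: R_def bij_betw_def)
        have "i \<in> part ` \<sigma>" by (simp add: im Y_def)
        then obtain v where v: "v \<in> \<sigma>" "part v = i" by auto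
        have "x \<in> ?A \<sigma> \<longleftrightarrow> x = v" for x
        proof
          assume "x \<in> ?A \<sigma>"
          then have "x \<in> \<sigma>" "part ` (\<sigma> - {x}) = X" by (auto simp: R_def bij_betw_def)
          then show "x = v" using v insert.hyps by blast
        next
          assume x: "x = v"
          have "part ` (\<sigma> - {v}) = X"
            using inj_on_image_set_diff[OF inj, of \<sigma> "{v}"] im v Yi by auto
          then show "x \<in> ?A \<sigma>" using x v inj \<sigma> by (auto simp: R_def bij_betw_def inj_on_diff)
        qed
        then have "?A \<sigma> = {v}" by blast
        then show ?thesis using True by simp
      next
        case nR: False
        show ?thesis
        proof (cases "?A \<sigma> = {}")
          case ne: False
          then obtain v where v: "v \<in> \<sigma>" and Rv: "\<sigma> - {v} \<in> R X" by blast
          then have inj: "inj_on part (\<sigma> - {v})" and im: "part ` (\<sigma> - {v}) = X"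
            by (auto simp: R_def bij_betw_def)
          have "part v \<noteq> i"
          proof
            assume "part v = i"
            define \<rho> where "\<rho> = \<sigma> - {v}"
            have "\<sigma> = insert v \<rho>" "inj_on part \<rho>" "part ` \<rho> = X" "v \<notin> \<rho>"
              using v inj im by (auto simp: \<rho>_def)
            then have "bij_betw part \<sigma> Y"
              using \<open>part v = i\<close> insert.hyps by (auto simp: bij_betw_def Y_def)
            then show False using nR \<sigma> by (auto simp: R_def)
          qed
          then have "part v \<in> X" using d(1) v by (auto simp: Y_def)
          then obtain x where x: "x \<in> \<sigma> - {v}" "part x = part v" using im by (metis imageE)
          \<comment> \<open>Only the colour shared by \<open>v\<close> and \<open>x\<close> repeats,
            so precisely these two removals leave a rainbow set, and they cancel.\<close>
          have "y \<in> ?A \<sigma> \<longleftrightarrow> y = v \<or> y = x" for y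
          proof
            assume y: "y \<in> ?A \<sigma>"
            then have "inj_on part (\<sigma> - {y})" by (auto simp: R_def bij_betw_def)
            then show "y = v \<or> y = x" using x v by (auto dest: inj_onD)
          next
            assume "y = v \<or> y = x"
            moreover have "bij_betw part (\<sigma> - {x}) X"
            proof -
              define \<rho> where "\<rho> = \<sigma> - {v} - {x}"
              have eq: "\<sigma> - {x} = insert v \<rho>" "\<sigma> - {v} = insert x \<rho>" "x \<notin> \<rho>" "v \<notin> \<rho>"
                using x v by (auto simp: \<rho>_def)
              have "inj_on part (insert x \<rho>)" "part ` insert x \<rho> = X" using inj im eq(2) by simp_all
              then show ?thesis unfolding eq(1) bij_betw_def using x(2) eq(3,4) by simp
            qed
            ultimately show "y \<in> ?A \<sigma>" using Rv v x \<sigma> by (auto simp: R_def)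
          qed
          then have "?A \<sigma> = {v, x}" by blast
          then show ?thesis using nR x by auto
        next
          case True
          show ?thesis unfolding True using nR by simp
        qed
      qed
    qed simp
  qed simp
  also have "\<dots> = (\<Sum>\<sigma>\<in>R Y. f Y \<sigma>)"
  proof -
    have "Pow W \<inter> R Y = R Y" by (auto simp: R_def)
    then show ?thesis using assms(1) by (simp flip: sum.inter_restrict)
  qed
  finally show ?case using one by (simp add: R_def Y_def)
qed

text \<open>The chain for all of \<open>I\<close> has rainbow coefficients of sum 1, so some rainbow
  simplex lies in its support and is therefore independent. The size condition pays for
  \<open>card X - 1\<close> explosions.\<close>

theorem independent_transversal:
  assumes W: "finite W" and I: "finite I"
    and F: "\<And>e. e \<in> F \<Longrightarrow> e \<subseteq> W \<and> card e = 2"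
    and small: "\<And>F'. F' \<subseteq> F \<Longrightarrow> F' \<noteq> {} \<Longrightarrow>
      \<exists>a b. {a, b} \<in> F' \<and> card (nbrs F' a \<union> nbrs F' b) \<le> \<kappa>"
    and size: "\<And>X. X \<subseteq> I \<Longrightarrow> X \<noteq> {} \<Longrightarrow> (card X - 1) * \<kappa> < card {v \<in> W. part v \<in> X}"
  shows "\<exists>T\<subseteq>W. indep F T \<and> bij_betw part T I"
proof -
  have "bounds_below W F {v \<in> W. part v \<in> X} (card X)" if X: "X \<subseteq> I" "X \<noteq> {}" for X
  proof -
    have "card X = Suc (card X - 1)"
      using X I by (simp add: card_gt_0_iff finite_subset)
    moreover have "bounds_below W {e \<in> F. e \<subseteq> {v \<in> W. part v \<in> X}} {v \<in> W. part v \<in> X}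
        (Suc (card X - 1))"
      by (rule bounds_below_small_explosions[OF W F small]) (use size[OF X] in auto)
    ultimately show ?thesis unfolding bounds_below_restrict by metis
  qed
  moreover have "{} \<notin> F" using F by fastforce
  ultimately obtain f where "f {} = (\<lambda>\<sigma>. if \<sigma> = {} then 1 else 0)"
    and f: "\<And>X. X \<subseteq> I \<Longrightarrow> X \<noteq> {} \<Longrightarrow> card X \<le> card I \<Longrightarrow>
      is_chain F {v \<in> W. part v \<in> X} (card X) (f X) \<and>
      boundary W (f X) = (\<lambda>\<tau>. \<Sum>i\<in>X. f (X - {i}) \<tau>)"
    using simplex_chains_exist[OF W I, of F part "card I"] by auto
  then have "(\<Sum>\<sigma> | \<sigma> \<subseteq> W \<and> bij_betw part \<sigma> I. f I \<sigma>) = 1"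
    using card_mono[OF I] by (intro rainbow_coefficient_sum[OF W I, of f F]) auto
  then obtain \<sigma> where s: "\<sigma> \<subseteq> W" "bij_betw part \<sigma> I" "f I \<sigma> \<noteq> 0"
    by (metis (mono_tags, lifting) mem_Collect_eq sum.neutral zero_neq_one)
  have "indep F \<sigma>"
  proof (cases "I = {}")
    case True
    then show ?thesis using s \<open>{} \<notin> F\<close> by (auto simp: indep_def bij_betw_def)
  next
    case False
    then show ?thesis using f[of I] is_chainD(3) s(3) by blast
  qed
  then show ?thesis using s by blast
qed

section \<open>Two-coloured paths\<close>

definition colors_at :: "'a set set \<Rightarrow> ('a set \<Rightarrow> nat) \<Rightarrow> 'a \<Rightarrow> nat set" where
  "colors_at E c v = c ` {e \<in> E. v \<in> e}"

definition path_edges :: "'a list \<Rightarrow> 'a set set" where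
  "path_edges p = (\<lambda>i. {p ! i, p ! Suc i}) ` {i. Suc i < length p}"

text \<open>For two colours, alternation comes from properness. Two vertices are demanded so that
  there is a first edge.\<close>

definition two_colored_path ::
    "'a set set \<Rightarrow> ('a set \<Rightarrow> nat) \<Rightarrow> nat set \<Rightarrow> 'a list \<Rightarrow> bool" where
  "two_colored_path E c A p \<longleftrightarrow>
     2 \<le> length p \<and> distinct p \<and> path_edges p \<subseteq> E \<and> c ` path_edges p \<subseteq> A"

definition linked :: "'a set set \<Rightarrow> ('a set \<Rightarrow> nat) \<Rightarrow> nat set \<Rightarrow> 'a \<Rightarrow> 'a \<Rightarrow> bool" where
  "linked E c A x y \<longleftrightarrow> (\<exists>p. two_colored_path E c A p \<and> hd p = x \<and> last p = y)"

lemma card_colors_at: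
  assumes "finite E"
  shows "finite (colors_at E c v)" "card (colors_at E c v) \<le> vertex_degree E v"
  using assms by (auto simp: colors_at_def vertex_degree_def intro!: card_image_le)

lemma two_colored_path_edge:
  assumes "two_colored_path E c A p" "Suc i < length p"
  shows "{p ! i, p ! Suc i} \<in> E" "c {p ! i, p ! Suc i} \<in> A"
    "c {p ! i, p ! Suc i} \<in> colors_at E c (p ! i)"
    "c {p ! i, p ! Suc i} \<in> colors_at E c (p ! Suc i)"
  using assms by (auto simp: two_colored_path_def path_edges_def colors_at_def)

lemma proper_edge_coloringD:
  assumes "proper_edge_coloring E N c" "{x, y} \<in> E" "{x, z} \<in> E" "c {x, y} = c {x, z}"
  shows "y = z"
  using assms unfolding proper_edge_coloring_def by (metis doubleton_eq_iff insert_disjoint(1) insert_iff)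

lemma path_edges_rev: "path_edges (rev p) = path_edges p"
proof -
  have "path_edges (rev p) \<subseteq> path_edges p" for p :: "'a list"
  proof
    fix e assume "e \<in> path_edges (rev p)"
    then obtain i where i: "Suc i < length p" "e = {rev p ! i, rev p ! Suc i}"
      by (auto simp: path_edges_def)
    define j where "j = length p - Suc (Suc i)"
    have "rev p ! i = p ! Suc j" "rev p ! Suc i = p ! j" "Suc j < length p"
      using i(1) by (auto simp: rev_nth j_def Suc_diff_Suc)
    then show "e \<in> path_edges p" using i(2) by (auto simp: path_edges_def insert_commute)
  qed
  from this[of p] this[of "rev p"] show ?thesis by simp
qed

lemma linked_sym: "linked E c A x y \<Longrightarrow> linked E c A y x"
  unfolding linked_def two_colored_path_def
  by (metis distinct_rev hd_rev last_rev length_rev path_edges_rev)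

text \<open>A path has no choice: at the start at most one of the two colours is present, later the
  colour must differ from that of the edge just used, and properness leaves at most one edge of that
  colour.\<close>

lemma two_colored_paths_agree:
  assumes c: "proper_edge_coloring E N c"
    and p: "two_colored_path E c {\<alpha>, \<beta>} p" and q: "two_colored_path E c {\<alpha>, \<beta>} q"
    and hd: "p ! 0 = q ! 0" and miss: "\<not> {\<alpha>, \<beta>} \<subseteq> colors_at E c (p ! 0)"
    and i: "i < length p" "i < length q"
  shows "p ! i = q ! i"
  using i
proof (induction i rule: less_induct)
  case (less i)
  note ep = two_colored_path_edge[OF p] and eq = two_colored_path_edge[OF q]
  show ?case
  proof (cases i)
    case 0
    then show ?thesis using hd by simp
  next
    case (Suc j)
    have pj: "p ! j = q ! j" using less Suc by simp
    have lp: "Suc j < length p" "Suc j < length q" using less.prems Suc by auto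
    have "c {p ! j, p ! Suc j} = c {p ! j, q ! Suc j}"
    proof (cases j)
      case 0
      then show ?thesis using miss ep(2,3)[OF lp(1)] eq(2,3)[OF lp(2)] hd by auto
    next
      case (Suc k)
      have pk: "p ! k = q ! k" using less \<open>i = Suc j\<close> Suc by simp
      have d: "p ! k \<noteq> p ! Suc j" "q ! k \<noteq> q ! Suc j"
        using p q lp Suc by (auto simp: two_colored_path_def nth_eq_iff_index_eq)
      have "c {p ! j, p ! k} \<noteq> c {p ! j, p ! Suc j}"
        using proper_edge_coloringD[OF c, of "p ! j" "p ! k" "p ! Suc j"] d(1)
          ep(1)[of k] ep(1)[of j] lp Suc by (auto simp: insert_commute)
      moreover have "c {p ! j, p ! k} \<noteq> c {p ! j, q ! Suc j}"
        using proper_edge_coloringD[OF c, of "q ! j" "q ! k" "q ! Suc j"] d(2)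
          eq(1)[of k] eq(1)[of j] lp Suc pj pk by (auto simp: insert_commute)
      moreover have "c {p ! j, p ! k} \<in> {\<alpha>, \<beta>}" using ep(2)[of k] lp Suc by (auto simp: insert_commute)
      ultimately show ?thesis
        using ep(2)[OF lp(1)] eq(2)[OF lp(2)] pj by auto
    qed
    then show ?thesis
      using proper_edge_coloringD[OF c] ep(1)[OF lp(1)] eq(1)[OF lp(2)] pj Suc by metis
  qed
qed

text \<open>By properness the edges before and after an inner vertex use up both colours.\<close>

lemma two_colored_path_inner_vertex:
  assumes c: "proper_edge_coloring E N c" and q: "two_colored_path E c {\<alpha>, \<beta>} q"
    and i: "0 < i" "Suc i < length q"
  shows "{\<alpha>, \<beta>} \<subseteq> colors_at E c (q ! i)"
proof -
  obtain k where k: "i = Suc k" using i by (cases i) auto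
  note eq = two_colored_path_edge[OF q]
  have "q ! k \<noteq> q ! Suc i"
    using q i k by (auto simp: two_colored_path_def nth_eq_iff_index_eq)
  then have "c {q ! i, q ! k} \<noteq> c {q ! i, q ! Suc i}"
    using proper_edge_coloringD[OF c, of "q ! i" "q ! k" "q ! Suc i"]
      eq(1)[of k] eq(1)[of i] i k by (auto simp: insert_commute)
  then show ?thesis
    using eq(2,4)[of k] eq(2,3)[of i] i k by (auto simp: insert_commute)
qed

text \<open>The two paths agree as long as both last, so a shorter one would end at an inner vertex
  of the longer, where both colours are present, contrary to \<open>miss\<close>.\<close>

lemma linked_unique:
  assumes c: "proper_edge_coloring E N c"
    and xy: "linked E c {\<alpha>, \<beta>} x y" and xz: "linked E c {\<alpha>, \<beta>} x z"
    and miss: "\<not> {\<alpha>, \<beta>} \<subseteq> colors_at E c x" "\<not> {\<alpha>, \<beta>} \<subseteq> colors_at E c y"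
      "\<not> {\<alpha>, \<beta>} \<subseteq> colors_at E c z"
  shows "y = z"
proof -
  obtain p q where p: "two_colored_path E c {\<alpha>, \<beta>} p" "hd p = x" "last p = y"
    and q: "two_colored_path E c {\<alpha>, \<beta>} q" "hd q = x" "last q = z"
    using xy xz by (auto simp: linked_def)
  have len: "2 \<le> length p" "2 \<le> length q" using p q by (auto simp: two_colored_path_def)
  then have ne: "p \<noteq> []" "q \<noteq> []" by auto
  have 0: "p ! 0 = q ! 0" "p ! 0 = x" using p q ne by (simp_all add: hd_conv_nth)
  have agree: "p ! i = q ! i" if "i < length p" "i < length q" for i
    using two_colored_paths_agree[OF c p(1) q(1) 0(1) _ that] miss 0 by simp
  have y: "y = p ! (length p - 1)" and z: "z = q ! (length q - 1)"
    using p q ne by (simp_all add: last_conv_nth)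
  have "\<not> length p < length q"
  proof
    assume l: "length p < length q"
    then have "y = q ! (length p - 1)" using y agree[of "length p - 1"] len by simp
    then show False
      using two_colored_path_inner_vertex[OF c q(1), of "length p - 1"] len l miss(2) by simp
  qed
  moreover have "\<not> length q < length p"
  proof
    assume l: "length q < length p"
    then have "z = p ! (length q - 1)" using z agree[of "length q - 1"] len by simp
    then show False
      using two_colored_path_inner_vertex[OF c p(1), of "length q - 1"] len l miss(3) by simp
  qed
  ultimately have "length p = length q" by simp
  then show ?thesis using y z agree[of "length p - 1"] len by simp
qed

lemma linked_first_color:
  assumes "linked E c A x y"
  shows "\<exists>a\<in>A. a \<in> colors_at E c x"
proof -
  obtain p where p: "two_colored_path E c A p" "hd p = x" using assms by (auto simp: linked_def)
  then have len: "2 \<le> length p" by (simp add: two_colored_path_def)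
  then have "p \<noteq> []" "Suc 0 < length p" by auto
  then have "Suc 0 < length p" "p ! 0 = x" using p by (simp_all add: hd_conv_nth)
  then show ?thesis using two_colored_path_edge(2,3)[OF p(1), of 0] by auto
qed

text \<open>As \<beta> is missing at \<open>y\<close>, the path starts with the edge
  \<open>yw\<close>. It cannot end at \<open>w\<close>, since \<alpha> is missing at
  \<open>x\<close>, so it goes on with colour \<beta>.\<close>

lemma linked_second_color:
  assumes c: "proper_edge_coloring E N c"
    and l: "linked E c {\<alpha>, \<beta>} y x" and w: "{y, w} \<in> E" "c {y, w} = \<alpha>"
    and "\<beta> \<notin> colors_at E c y" "\<alpha> \<notin> colors_at E c x"
  shows "\<beta> \<in> colors_at E c w"
proof -
  obtain p where p: "two_colored_path E c {\<alpha>, \<beta>} p" "hd p = y" "last p = x"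
    using l by (auto simp: linked_def)
  note ep = two_colored_path_edge[OF p(1)]
  have len: "2 \<le> length p" "p \<noteq> []" using p by (auto simp: two_colored_path_def)
  then have p0: "p ! 0 = y" using p by (simp add: hd_conv_nth)
  have "c {y, p ! 1} = \<alpha>" "{y, p ! 1} \<in> E" using ep[of 0] len p0 assms(5) by auto
  then have p1: "p ! 1 = w" using proper_edge_coloringD[OF c _ w(1)] w(2) by metis
  have "length p \<noteq> 2"
  proof
    assume "length p = 2"
    then have "x = w" using p(3) p1 len by (simp add: last_conv_nth)
    then show False using w assms(6) by (auto simp: colors_at_def)
  qed
  then have "{\<alpha>, \<beta>} \<subseteq> colors_at E c (p ! 1)"
    using two_colored_path_inner_vertex[OF c p(1), of 1] len by simp
  then show ?thesis using p1 by simp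
qed

text \<open>Here \<open>l\<close> counts choices of one colour, \<open>d\<close> is their least link
  degree and \<open>k\<close> counts the neighbours of \<open>u\<close> seeing the colour. For
  \<open>2 * l \<le> Suc D\<close> the bound \<open>d \<le> D\<close> suffices. Otherwise
  \<open>d * l \<le> D * (D + 1 - l)\<close> gives \<open>l * (3 * D + 1 - 2 * l - 2 * d) \<ge> (2 *
  l - D - 1) * (2 * D - l)\<close>, and both factors on the right are nonnegative.\<close>

lemma explosion_size_bound:
  fixes d l k D :: nat
  assumes "d \<le> D" "d * l \<le> D * k" "l + k \<le> Suc D" "1 \<le> D"
  shows "2 * (l + d + D) \<le> 5 * D + 1"
proof (cases "2 * l \<le> Suc D")
  case False
  have "int d * int l \<le> int D * int k" using assms(2) by (simp flip: of_nat_mult)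
  also have "\<dots> \<le> int D * (int D + 1 - int l)" using assms(3) by (intro mult_left_mono) auto
  finally have "int l * (3 * int D + 1 - 2 * int l - 2 * int d)
      \<ge> int l * (3 * int D + 1 - 2 * int l) - 2 * (int D * (int D + 1 - int l))"
    by (simp add: algebra_simps)
  also have "int l * (3 * int D + 1 - 2 * int l) - 2 * (int D * (int D + 1 - int l))
      = (2 * int l - int D - 1) * (2 * int D - int l)" by (simp add: algebra_simps)
  finally have "int l * (3 * int D + 1 - 2 * int l - 2 * int d)
      \<ge> (2 * int l - int D - 1) * (2 * int D - int l)" .
  moreover have "(2 * int l - int D - 1) * (2 * int D - int l) \<ge> 0"
    using False assms by (intro mult_nonneg_nonneg) auto
  ultimately have "0 \<le> int l * (3 * int D + 1 - 2 * int l - 2 * int d)" by linarith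
  moreover have "0 < int l" using False by simp
  ultimately show ?thesis by (simp add: zero_le_mult_iff)
qed (use assms in simp)

section \<open>Colouring the star of a vertex\<close>

locale star_extension =
  fixes E :: "'a set set" and u :: 'a and D N :: nat and \<phi> :: "'a set \<Rightarrow> nat"
  assumes fin: "finite E" and card2: "\<And>e. e \<in> E \<Longrightarrow> card e = 2"
    and degree: "\<And>v. vertex_degree E v \<le> Suc D" and D: "1 \<le> D"
    and acyc: "acyclic_edge_coloring {e \<in> E. u \<notin> e} N \<phi>"
begin

abbreviation "E0 \<equiv> {e \<in> E. u \<notin> e}"
abbreviation "C \<equiv> colors_at E0 \<phi>"

text \<open>
  A pair \<open>(x, \<alpha>)\<close> in \<open>W\<close> stands for giving colour \<open>\<alpha>\<close> to the edge \<open>ux\<close>. The edges of the conflict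
  graph are the pairs of choices violating properness at \<open>u\<close> and those closing a two-coloured cycle.
\<close>

definition "I = {x. {u, x} \<in> E}"
definition "W = {(x, \<alpha>). x \<in> I \<and> \<alpha> \<in> {1..N} \<and> \<alpha> \<notin> C x}"
definition "mono_edges = {{(x, \<alpha>), (y, \<alpha>)} | x y \<alpha>. x \<noteq> y \<and> (x, \<alpha>) \<in> W \<and> (y, \<alpha>) \<in> W}"
definition "link_edges = {{(x, \<alpha>), (y, \<beta>)} | x y \<alpha> \<beta>. x \<noteq> y \<and> \<alpha> \<noteq> \<beta> \<and>
  (x, \<alpha>) \<in> W \<and> (y, \<beta>) \<in> W \<and> linked E0 \<phi> {\<alpha>, \<beta>} x y}"

lemma proper: "proper_edge_coloring E0 N \<phi>"
  using acyc by (simp add: acyclic_edge_coloring_def)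

lemma u_notin_I: "u \<notin> I"
  using card2 by (fastforce simp: I_def)

lemma finite_I: "finite I" and card_I: "card I \<le> Suc D"
proof -
  have inj: "inj_on (\<lambda>x. {u, x}) I" by (auto simp: inj_on_def doubleton_eq_iff)
  have sub: "(\<lambda>x. {u, x}) ` I \<subseteq> {e \<in> E. u \<in> e}" by (auto simp: I_def)
  have fe: "finite {e \<in> E. u \<in> e}" using fin by simp
  show "finite I" using finite_subset[OF sub fe] inj by (rule finite_imageD)
  have "card I \<le> card {e \<in> E. u \<in> e}" by (rule card_inj_on_le[OF inj sub fe])
  then show "card I \<le> Suc D" using degree[of u] by (simp add: vertex_degree_def)
qed

lemma finite_C: "finite (C v)" and card_C: "card (C v) \<le> Suc D"
proof -
  have "vertex_degree E0 v \<le> vertex_degree E v"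
    unfolding vertex_degree_def using fin by (intro card_mono) auto
  then show "finite (C v)" "card (C v) \<le> Suc D"
    using card_colors_at[of E0 \<phi> v] fin degree[of v] by auto
qed

text \<open>The edge from \<open>u\<close> to \<open>x\<close> is not in \<open>E0\<close>, which
  saves one colour.\<close>

lemma card_C_I: assumes "x \<in> I" shows "card (C x) \<le> D"
proof -
  have "{u, x} \<in> {e \<in> E. x \<in> e}" "{u, x} \<notin> {e \<in> E0. x \<in> e}" using assms by (auto simp: I_def)
  moreover have "{e \<in> E0. x \<in> e} \<subseteq> {e \<in> E. x \<in> e}" by auto
  ultimately have "{e \<in> E0. x \<in> e} \<subset> {e \<in> E. x \<in> e}" by (metis psubsetI)
  then have "vertex_degree E0 x < vertex_degree E x"
    unfolding vertex_degree_def using fin by (intro psubset_card_mono) auto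
  then show ?thesis using card_colors_at[of E0 \<phi> x] fin degree[of x] by auto
qed

lemma finite_W: "finite W"
  by (rule finite_subset[of _ "I \<times> {1..N}"]) (auto simp: W_def finite_I)

lemma edges: assumes "e \<in> mono_edges \<union> link_edges" shows "e \<subseteq> W \<and> card e = 2"
  using assms by (auto simp: mono_edges_def link_edges_def)

lemma nbrs_link_edges:
  assumes "(y, \<beta>) \<in> nbrs link_edges (x, \<alpha>)"
  shows "x \<noteq> y" "\<alpha> \<noteq> \<beta>" "(x, \<alpha>) \<in> W" "(y, \<beta>) \<in> W" "linked E0 \<phi> {\<alpha>, \<beta>} x y"
  using assms linked_sym[of E0 \<phi> "{\<alpha>, \<beta>}" y x]
  by (auto simp: nbrs_def link_edges_def doubleton_eq_iff insert_commute)

lemma finite_nbrs: "F \<subseteq> mono_edges \<union> link_edges \<Longrightarrow> finite (nbrs F v)"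
  by (rule finite_subset[OF _ finite_W]) (use edges in \<open>fastforce simp: nbrs_def\<close>)

text \<open>A link neighbour \<open>(y, \<beta>)\<close> of \<open>(x, \<alpha>)\<close> is
  determined by \<beta>, and \<beta> occurs at \<open>x\<close> because \<alpha> does not.\<close>

lemma card_nbrs_link_edges: "card (nbrs link_edges v) \<le> D"
proof (cases "nbrs link_edges v = {}")
  case False
  obtain x \<alpha> where v: "v = (x, \<alpha>)" by (cases v)
  have xW: "(x, \<alpha>) \<in> W" using False nbrs_link_edges(3)[of _ _ x \<alpha>] v by force
  have "inj_on snd (nbrs link_edges v)"
  proof (rule inj_onI)
    fix a b assume ab: "a \<in> nbrs link_edges v" "b \<in> nbrs link_edges v" "snd a = snd b"
    obtain y \<beta> z where e: "a = (y, \<beta>)" "b = (z, \<beta>)" using ab(3) by (metis prod.collapse)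
    have "y = z"
      using nbrs_link_edges[of y \<beta> x \<alpha>] nbrs_link_edges[of z \<beta> x \<alpha>] ab e v
      by (intro linked_unique[OF proper, of \<alpha> \<beta> x y z]) (auto simp: W_def)
    then show "a = b" using e by simp
  qed
  moreover have "snd ` nbrs link_edges v \<subseteq> C x"
  proof
    fix \<beta> assume "\<beta> \<in> snd ` nbrs link_edges v"
    then obtain y where "(y, \<beta>) \<in> nbrs link_edges (x, \<alpha>)" using v by auto
    then have "linked E0 \<phi> {\<alpha>, \<beta>} x y" by (rule nbrs_link_edges)
    then show "\<beta> \<in> C x" using linked_first_color[of E0 \<phi> "{\<alpha>, \<beta>}" x y] xW by (auto simp: W_def)
  qed
  ultimately have "card (nbrs link_edges v) \<le> card (C x)"
    using finite_C card_inj_on_le by blast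
  then show ?thesis using card_C_I[of x] xW by (auto simp: W_def)
qed simp

text \<open>The conflicts are counted by their other end \<open>(y, \<beta>)\<close>. The path
  leaves \<open>y\<close> by its edge \<open>yw\<close> of colour \<alpha> and then needs \<beta> at
  \<open>w\<close>, where at most \<open>D\<close> colours differ from \<alpha>; and
  \<open>y\<close>, \<alpha>, \<beta> determine \<open>x\<close>.\<close>

lemma sum_card_nbrs_link_edges:
  assumes "finite S" and S: "\<And>v. v \<in> S \<Longrightarrow> snd v = \<alpha>"
  shows "(\<Sum>v\<in>S. card (nbrs link_edges v)) \<le> D * card {y \<in> I. \<alpha> \<in> C y}"
proof -
  let ?K = "{y \<in> I. \<alpha> \<in> C y}"
  define P where "P = (SIGMA v:S. nbrs link_edges v)"
  define Q where "Q = (\<lambda>y. {(v, b). (v, b) \<in> P \<and> fst b = y})"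
  have finP: "finite P" unfolding P_def using assms(1) finite_nbrs by auto
  have "P \<subseteq> (\<Union>y\<in>?K. Q y)"
  proof
    fix e assume e: "e \<in> P"
    then obtain x y \<beta> where eq: "e = ((x, \<alpha>), (y, \<beta>))" and n: "(y, \<beta>) \<in> nbrs link_edges (x, \<alpha>)"
      using S by (force simp: P_def)
    note l = nbrs_link_edges[OF n]
    have "\<alpha> \<in> C y"
      using linked_first_color[OF linked_sym[OF l(5)]] l(4) by (auto simp: W_def)
    then have "y \<in> ?K" using l(4) by (auto simp: W_def)
    then show "e \<in> (\<Union>y\<in>?K. Q y)" using e eq by (auto simp: Q_def)
  qed
  then have "card P \<le> card (\<Union>y\<in>?K. Q y)"
    using finite_I finP by (intro card_mono) (auto simp: Q_def intro: finite_subset)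
  also have "\<dots> \<le> (\<Sum>y\<in>?K. card (Q y))" by (rule card_UN_le) (simp add: finite_I)
  also have "\<dots> \<le> (\<Sum>y\<in>?K. D)"
  proof (rule sum_mono)
    fix y assume y: "y \<in> ?K"
    then obtain f where f: "f \<in> E0" "y \<in> f" "\<phi> f = \<alpha>" by (auto simp: colors_at_def)
    then obtain w where w: "f = {y, w}" using card2[of f] by (auto simp: card_2_iff)
    have Qd: "\<exists>x \<beta>. e = ((x, \<alpha>), (y, \<beta>)) \<and> (y, \<beta>) \<in> nbrs link_edges (x, \<alpha>)" if "e \<in> Q y" for e
      using that S by (force simp: Q_def P_def)
    have "inj_on (\<lambda>e. snd (snd e)) (Q y)"
    proof (rule inj_onI)
      fix e e' assume ee: "e \<in> Q y" "e' \<in> Q y" "snd (snd e) = snd (snd e')"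
      obtain x x' \<beta> where eq: "e = ((x, \<alpha>), (y, \<beta>))" "e' = ((x', \<alpha>), (y, \<beta>))"
        and n: "(y, \<beta>) \<in> nbrs link_edges (x, \<alpha>)" "(y, \<beta>) \<in> nbrs link_edges (x', \<alpha>)"
        using Qd[OF ee(1)] Qd[OF ee(2)] ee(3) by auto
      have "x = x'"
        using nbrs_link_edges[OF n(1)] nbrs_link_edges[OF n(2)]
        by (intro linked_unique[OF proper, of \<alpha> \<beta> y x x']) (auto simp: W_def intro: linked_sym)
      then show "e = e'" using eq by simp
    qed
    moreover have "(\<lambda>e. snd (snd e)) ` Q y \<subseteq> C w - {\<alpha>}"
    proof
      fix \<beta> assume "\<beta> \<in> (\<lambda>e. snd (snd e)) ` Q y"
      then obtain x where n: "(y, \<beta>) \<in> nbrs link_edges (x, \<alpha>)" using Qd by force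
      note l = nbrs_link_edges[OF n]
      have "\<beta> \<in> C w"
        using l f w by (intro linked_second_color[OF proper linked_sym[OF l(5)]]) (auto simp: W_def)
      then show "\<beta> \<in> C w - {\<alpha>}" using l by simp
    qed
    ultimately have "card (Q y) \<le> card (C w - {\<alpha>})"
      using finite_C by (intro card_inj_on_le) auto
    also have "\<dots> \<le> D"
    proof -
      have "\<alpha> \<in> C w" using f w by (auto simp: colors_at_def)
      then show ?thesis using card_C[of w] finite_C[of w] by simp
    qed
    finally show "card (Q y) \<le> D" .
  qed
  finally have "card P \<le> D * card ?K" by (simp add: mult.commute)
  moreover have "card P = (\<Sum>v\<in>S. card (nbrs link_edges v))"
    unfolding P_def using assms(1) finite_nbrs by (intro card_SigmaI) auto
  ultimately show ?thesis by simp
qed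

text \<open>
  Explode an edge between equally coloured choices as long as there is one, with one end \<open>a\<close> of
  minimum link degree among the choices of colour \<open>\<alpha>\<close> that still have such an edge: many of these
  leave few vertices that see \<open>\<alpha>\<close>, so by the previous bound the link degree of \<open>a\<close> is small.
\<close>

lemma small_explosion:
  assumes F: "F \<subseteq> mono_edges \<union> link_edges" "F \<noteq> {}"
  shows "\<exists>a b. {a, b} \<in> F \<and> card (nbrs F a \<union> nbrs F b) \<le> (5 * D + 1) div 2"
proof -
  define M B where "M = F \<inter> mono_edges" and "B = F \<inter> link_edges"
  have nF: "nbrs F v = nbrs M v \<union> nbrs B v" for v
    using F by (auto simp: nbrs_def M_def B_def)
  have finB: "finite (nbrs link_edges v)" for v by (rule finite_nbrs) simp
  have cB: "card (nbrs B v) \<le> card (nbrs link_edges v)" for v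
    by (rule card_mono[OF finB nbrs_mono]) (simp add: B_def)
  have cB': "card (nbrs B v) \<le> D" for v using cB card_nbrs_link_edges le_trans by blast
  show ?thesis
  proof (cases "M = {}")
    \<comment> \<open>Link degrees alone give \<open>D + D\<close>, which is within the
      bound.\<close>
    case True
    obtain e where e: "e \<in> F" using F by blast
    then have "card e = 2" using edges[of e] F by blast
    then obtain a b where ab: "e = {a, b}" unfolding card_2_iff by blast
    have "nbrs F v = nbrs B v" for v using nF True by (simp add: nbrs_def)
    then have "card (nbrs F a \<union> nbrs F b) \<le> D + D"
      using card_Un_le[of "nbrs B a" "nbrs B b"] cB'[of a] cB'[of b] by simp
    then show ?thesis using e ab D by (intro exI[of _ a] exI[of _ b]) auto
  next
    case False
    then obtain e where e: "e \<in> M" by blast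
    then obtain x0 y0 \<alpha> where "e = {(x0, \<alpha>), (y0, \<alpha>)}" unfolding M_def mono_edges_def by blast
    with e have e0: "{(x0, \<alpha>), (y0, \<alpha>)} \<in> M" by simp
    have nM: "snd b = snd v \<and> b \<in> W \<and> v \<in> W \<and> v \<in> nbrs M b" if "b \<in> nbrs M v" for b v
      using that by (auto simp: nbrs_def M_def mono_edges_def doubleton_eq_iff insert_commute)
    define S where "S = {v. snd v = \<alpha> \<and> nbrs M v \<noteq> {}}"
    have SW: "S \<subseteq> W" using nM by (auto simp: S_def)
    then have finS: "finite S" using finite_W finite_subset by blast
    have "(x0, \<alpha>) \<in> S" using e0 by (auto simp: S_def nbrs_def)
    then have "S \<noteq> {}" by blast
    define a where "a = arg_min_on (\<lambda>v. card (nbrs B v)) S"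
    have a: "a \<in> S" unfolding a_def using finS \<open>S \<noteq> {}\<close> by (rule arg_min_if_finite)
    have amin: "card (nbrs B a) \<le> card (nbrs B v)" if "v \<in> S" for v
      unfolding a_def using finS \<open>S \<noteq> {}\<close> that by (rule arg_min_least)
    from a obtain b where b: "b \<in> nbrs M a" by (auto simp: S_def)
    have nS: "nbrs M v \<subseteq> S" if "v \<in> S" for v
      using nM that by (fastforce simp: S_def)
    have bS: "b \<in> S" using nS[OF a] b by blast
    define k where "k = card {y \<in> I. \<alpha> \<in> C y}"
    have "card (nbrs B a) * card S \<le> (\<Sum>v\<in>S. card (nbrs B v))"
      using sum_mono[of S "\<lambda>_. card (nbrs B a)" "\<lambda>v. card (nbrs B v)"] amin
      by (simp add: mult.commute)
    also have "\<dots> \<le> (\<Sum>v\<in>S. card (nbrs link_edges v))" using cB by (rule sum_mono)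
    also have "\<dots> \<le> D * k"
      unfolding k_def using finS by (rule sum_card_nbrs_link_edges) (simp add: S_def)
    finally have dl: "card (nbrs B a) * card S \<le> D * k" .
    have "card S \<le> card {y \<in> I. \<alpha> \<notin> C y}"
    proof (rule card_inj_on_le[of fst])
      show "inj_on fst S" by (auto simp: inj_on_def S_def)
      show "fst ` S \<subseteq> {y \<in> I. \<alpha> \<notin> C y}" using SW by (auto simp: S_def W_def)
    qed (simp add: finite_I)
    moreover have "card {y \<in> I. \<alpha> \<notin> C y} + k = card I"
    proof -
      have "card ({y \<in> I. \<alpha> \<notin> C y} \<union> {y \<in> I. \<alpha> \<in> C y}) = card {y \<in> I. \<alpha> \<notin> C y} + k"
        unfolding k_def using finite_I by (intro card_Un_disjoint) auto
      moreover have "{y \<in> I. \<alpha> \<notin> C y} \<union> {y \<in> I. \<alpha> \<in> C y} = I" by blast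
      ultimately show ?thesis by simp
    qed
    ultimately have lk: "card S + k \<le> Suc D" using card_I by simp
    \<comment> \<open>The equally coloured neighbours of both ends lie in the one set
      \<open>S\<close>, so they are paid for only once.\<close>
    have "nbrs F a \<union> nbrs F b \<subseteq> S \<union> (nbrs B a \<union> nbrs B b)" using nF nS[OF a] nS[OF bS] by auto
    moreover have "finite (S \<union> (nbrs B a \<union> nbrs B b))"
      using finS finite_subset[OF nbrs_mono finB, of B] by (simp add: B_def)
    ultimately have "card (nbrs F a \<union> nbrs F b) \<le> card (S \<union> (nbrs B a \<union> nbrs B b))" by (rule card_mono[rotated])
    also have "\<dots> \<le> card S + (card (nbrs B a) + card (nbrs B b))"
      by (meson add_left_mono card_Un_le le_trans)
    also have "\<dots> \<le> card S + card (nbrs B a) + D" using cB'[of b] by simp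
    finally have "2 * card (nbrs F a \<union> nbrs F b) \<le> 2 * (card S + card (nbrs B a) + D)"
      by (rule mult_le_mono2)
    also have "\<dots> \<le> 5 * D + 1" by (rule explosion_size_bound[OF cB' dl lk D])
    finally have "2 * card (nbrs F a \<union> nbrs F b) \<le> 5 * D + 1" .
    moreover have "{a, b} \<in> F" using b by (simp add: nbrs_def M_def)
    ultimately show ?thesis by (intro exI[of _ a] exI[of _ b]) auto
  qed
qed

end

section \<open>Cycles through the deleted vertex and the extension\<close>

lemma cycle_edges_rotate: "cycle_edges (rotate k p) \<subseteq> cycle_edges p"
proof
  fix e assume "e \<in> cycle_edges (rotate k p)"
  then obtain i where i: "i < length p"
    and e: "e = {rotate k p ! i, rotate k p ! (Suc i mod length p)}"
    by (auto simp: cycle_edges_def)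
  define j where "j = (k + i) mod length p"
  have "0 < length p" using i by auto
  then have "Suc i mod length p < length p" "j < length p" by (simp_all add: j_def)
  moreover have "(k + Suc i mod length p) mod length p = Suc j mod length p"
    by (simp add: j_def mod_simps)
  ultimately have "e = {p ! j, p ! (Suc j mod length p)}"
    using i e by (simp add: nth_rotate j_def)
  then show "e \<in> cycle_edges p" using \<open>j < length p\<close> by (auto simp: cycle_edges_def)
qed

lemma cycle_edges_Cons:
  assumes "q \<noteq> []"
  shows "path_edges q \<subseteq> cycle_edges (u # q)" "{u, hd q} \<in> cycle_edges (u # q)"
    "{u, last q} \<in> cycle_edges (u # q)"
proof -
  show "path_edges q \<subseteq> cycle_edges (u # q)"
  proof
    fix e assume "e \<in> path_edges q"
    then obtain i where i: "Suc i < length q" "e = {q ! i, q ! Suc i}" by (auto simp: path_edges_def)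
    then show "e \<in> cycle_edges (u # q)"
      unfolding cycle_edges_def by (intro image_eqI[of _ _ "Suc i"]) auto
  qed
  show "{u, hd q} \<in> cycle_edges (u # q)"
    unfolding cycle_edges_def using assms
    by (intro image_eqI[of _ _ 0]) (auto simp: hd_conv_nth)
  show "{u, last q} \<in> cycle_edges (u # q)"
    unfolding cycle_edges_def using assms
    by (intro image_eqI[of _ _ "length q"]) (auto simp: last_conv_nth nth_Cons')
qed

lemma is_cycle_avoiding:
  assumes "is_cycle E p" "u \<notin> set p"
  shows "is_cycle {e \<in> E. u \<notin> e} p"
proof -
  have "u \<notin> e" if "e \<in> cycle_edges p" for e
  proof -
    from that obtain i where e: "e = {p ! i, p ! (Suc i mod length p)}" and "i \<in> {..<length p}"
      unfolding cycle_edges_def by (rule imageE)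
    then have i: "i < length p" by simp
    then have "0 < length p" by (rule le_less_trans[OF le0])
    then have "p ! i \<in> set p" "p ! (Suc i mod length p) \<in> set p" using i by simp_all
    then show ?thesis using e assms(2) by auto
  qed
  then show ?thesis using assms(1) by (auto simp: is_cycle_def)
qed

context star_extension
begin

text \<open>An independent transversal with one part for each neighbour \<open>x\<close> of
  \<open>u\<close>, namely the colours missing at \<open>x\<close>, at least \<open>N - D\<close> of
  them. In \<open>num\<close>, \<open>m\<close> is the number of parts taken together.\<close>

lemma conflict_free_choice:
  assumes num: "\<And>m. 1 \<le> m \<Longrightarrow> m \<le> Suc D \<Longrightarrow> (m - 1) * ((5 * D + 1) div 2) < m * (N - D)"
  shows "\<exists>g. (\<forall>x\<in>I. g x \<in> {1..N} \<and> g x \<notin> C x) \<and>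
    (\<forall>x\<in>I. \<forall>y\<in>I. x \<noteq> y \<longrightarrow> g x \<noteq> g y \<and> \<not> linked E0 \<phi> {g x, g y} x y)"
proof -
  have "\<exists>T\<subseteq>W. indep (mono_edges \<union> link_edges) T \<and> bij_betw fst T I"
  proof (rule independent_transversal[OF finite_W finite_I edges small_explosion])
    fix X assume X: "X \<subseteq> I" "X \<noteq> {}"
    have fX: "finite X" using X finite_I finite_subset by blast
    have m: "1 \<le> card X" "card X \<le> Suc D"
      using X fX card_I card_mono[OF finite_I X(1)] by (auto simp: Suc_le_eq card_gt_0_iff)
    have "card X * (N - D) = (\<Sum>x\<in>X. N - D)" by simp
    also have "\<dots> \<le> (\<Sum>x\<in>X. card ({1..N} - C x))"
    proof (rule sum_mono)
      fix x assume "x \<in> X"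
      then have "card (C x) \<le> D" using X card_C_I by blast
      moreover have "card {1..N} - card (C x) \<le> card ({1..N} - C x)"
        by (rule diff_card_le_card_Diff[OF finite_C])
      ultimately show "N - D \<le> card ({1..N} - C x)" by simp
    qed
    also have "\<dots> = card (SIGMA x:X. {1..N} - C x)" using fX by simp
    also have "(SIGMA x:X. {1..N} - C x) = {v \<in> W. fst v \<in> X}" using X by (auto simp: W_def)
    finally show "(card X - 1) * ((5 * D + 1) div 2) < card {v \<in> W. fst v \<in> X}"
      using num[OF m] by (rule less_le_trans[rotated])
  qed
  then obtain T where T: "T \<subseteq> W" "indep (mono_edges \<union> link_edges) T" "bij_betw fst T I" by blast
  define g where "g = (\<lambda>x. snd (inv_into T fst x))"
  have gT: "(x, g x) \<in> T" if "x \<in> I" for x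
  proof -
    have x: "x \<in> fst ` T" using T(3) that by (simp add: bij_betw_def)
    have "inv_into T fst x \<in> T" "fst (inv_into T fst x) = x"
      using inv_into_into[OF x] f_inv_into_f[OF x] by auto
    then show ?thesis by (metis g_def prod.collapse)
  qed
  then have gW: "(x, g x) \<in> W" if "x \<in> I" for x using T(1) that by blast
  have "g x \<noteq> g y \<and> \<not> linked E0 \<phi> {g x, g y} x y" if "x \<in> I" "y \<in> I" "x \<noteq> y" for x y
  proof -
    have "{(x, g x), (y, g y)} \<subseteq> T" using gT that by auto
    then have n: "{(x, g x), (y, g y)} \<notin> mono_edges \<union> link_edges" using indepD[OF T(2)] by blast
    have "g x \<noteq> g y"
    proof
      assume "g x = g y"
      then have "{(x, g x), (y, g y)} \<in> mono_edges"
        unfolding mono_edges_def using gW[OF that(1)] gW[OF that(2)] that(3) by auto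
      then show False using n by simp
    qed
    moreover have "\<not> linked E0 \<phi> {g x, g y} x y"
    proof
      assume "linked E0 \<phi> {g x, g y} x y"
      then have "{(x, g x), (y, g y)} \<in> link_edges"
        unfolding link_edges_def using gW[OF that(1)] gW[OF that(2)] that(3) calculation by blast
      then show False using n by simp
    qed
    ultimately show ?thesis by blast
  qed
  then show ?thesis using gW by (intro exI[of _ g]) (auto simp: W_def)
qed

text \<open>Cycles avoiding \<open>u\<close> keep their colours. A cycle through \<open>u\<close>
  uses two edges \<open>ux\<close> and \<open>uy\<close>; with only two colours in all, its
  remainder would be a path linking \<open>x\<close> to \<open>y\<close> in the colours
  \<open>g x\<close>, \<open>g y\<close>, which the choice of \<open>g\<close> excludes.\<close>

lemma acyclic_extension:
  assumes "\<And>m. 1 \<le> m \<Longrightarrow> m \<le> Suc D \<Longrightarrow> (m - 1) * ((5 * D + 1) div 2) < m * (N - D)"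
  shows "\<exists>c. acyclic_edge_coloring E N c"
proof -
  obtain g where gN: "\<And>x. x \<in> I \<Longrightarrow> g x \<in> {1..N} \<and> g x \<notin> C x"
    and gg: "\<And>x y. x \<in> I \<Longrightarrow> y \<in> I \<Longrightarrow> x \<noteq> y \<Longrightarrow> g x \<noteq> g y \<and> \<not> linked E0 \<phi> {g x, g y} x y"
    using conflict_free_choice[OF assms] by blast
  define c where "c = (\<lambda>e. if u \<in> e then g (the_elem (e - {u})) else \<phi> e)"
  have c_star: "c {u, x} = g x" if "x \<in> I" for x
  proof -
    have "{u, x} - {u} = {x}" using that u_notin_I by auto
    then show ?thesis by (simp add: c_def)
  qed
  have c_E0: "c e = \<phi> e" if "u \<notin> e" for e using that by (simp add: c_def)
  have star: "\<exists>x\<in>I. e = {u, x}" if "e \<in> E" "u \<in> e" for e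
    using that card2[of e] by (auto simp: card_2_iff I_def insert_commute)
  have \<phi>N: "\<phi> e \<in> {1..N}" if "e \<in> E0" for e
    using proper that by (auto simp: proper_edge_coloring_def edge_coloring_def)
  have mixed: "c {u, x} \<noteq> c f" if "x \<in> I" "f \<in> E" "u \<notin> f" "{u, x} \<inter> f \<noteq> {}" for x f
  proof -
    have "x \<in> f" using that by auto
    then have "c f \<in> C x" using that c_E0 by (auto simp: colors_at_def)
    then show ?thesis using gN[OF that(1)] c_star[OF that(1)] by auto
  qed
  have "proper_edge_coloring E N c"
    unfolding proper_edge_coloring_def edge_coloring_def
  proof (intro conjI ballI impI)
    show "c \<in> E \<rightarrow> {1..N}"
    proof
      fix e assume e: "e \<in> E"
      show "c e \<in> {1..N}"
      proof (cases "u \<in> e")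
        case True
        then show ?thesis using star[OF e] c_star gN by fastforce
      next
        case False
        then show ?thesis using \<phi>N[of e] c_E0 e by simp
      qed
    qed
  next
    fix e f assume e: "e \<in> E" and f: "f \<in> E" and ef: "e \<noteq> f \<and> e \<inter> f \<noteq> {}"
    show "c e \<noteq> c f"
    proof (cases "u \<in> e")
      case True
      then obtain x where x: "x \<in> I" "e = {u, x}" using star[OF e] by blast
      show ?thesis
      proof (cases "u \<in> f")
        case True
        then obtain y where y: "y \<in> I" "f = {u, y}" using star[OF f] by blast
        then have "x \<noteq> y" using x ef by blast
        then show ?thesis using gg x y c_star by simp
      next
        case False
        then show ?thesis using mixed x f ef by blast
      qed
    next
      case ue: False
      show ?thesis
      proof (cases "u \<in> f")
        case True
        then obtain y where y: "y \<in> I" "f = {u, y}" using star[OF f] by blast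
        then have "c {u, y} \<noteq> c e" using mixed[of y e] e ue ef by (simp add: Int_commute)
        then show ?thesis using y by simp
      next
        case False
        then show ?thesis
          using proper ue e f ef c_E0 unfolding proper_edge_coloring_def by simp
      qed
    qed
  qed
  moreover have "3 \<le> card (c ` cycle_edges p)" if p: "is_cycle E p" for p
  proof (cases "u \<in> set p")
    case False
    then have cyc: "is_cycle E0 p" using is_cycle_avoiding[OF p] by blast
    then have "c ` cycle_edges p = \<phi> ` cycle_edges p"
      using c_E0 by (intro image_cong) (auto simp: is_cycle_def)
    then show ?thesis using acyc cyc by (simp add: acyclic_edge_coloring_def)
  next
    case True
    \<comment> \<open>Rotation puts \<open>u\<close> first, so that \<open>q\<close> is the cycle
      with \<open>u\<close> removed.\<close>
    then obtain k where k: "k < length p" "p ! k = u" by (auto simp: in_set_conv_nth)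
    then have "p \<noteq> []" by auto
    then have "rotate k p \<noteq> []" "hd (rotate k p) = u"
      using hd_rotate_conv_nth[of p k] k by simp_all
    then obtain q where q: "rotate k p = u # q" by (cases "rotate k p") auto
    have dq: "distinct (u # q)" "2 \<le> length q"
      using p length_rotate[of k p] distinct_rotate[of k p] unfolding is_cycle_def q by simp_all
    then have ne: "q \<noteq> []" by auto
    let ?x = "hd q" and ?y = "last q"
    have sub: "cycle_edges (u # q) \<subseteq> cycle_edges p" using cycle_edges_rotate[of k p] q by simp
    have subE: "cycle_edges p \<subseteq> E" using p by (simp add: is_cycle_def)
    note ce = cycle_edges_Cons[OF ne, of u]
    have xy: "?x \<in> I" "?y \<in> I" using ce sub subE by (auto simp: I_def)
    have "?x \<noteq> ?y"
      using dq ne by (simp add: hd_conv_nth last_conv_nth nth_eq_iff_index_eq)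
    then have g: "g ?x \<noteq> g ?y" "\<not> linked E0 \<phi> {g ?x, g ?y} ?x ?y" using gg xy by auto
    show ?thesis
    proof (rule ccontr)
      assume "\<not> 3 \<le> card (c ` cycle_edges p)"
      moreover have "{g ?x, g ?y} \<subseteq> c ` cycle_edges p"
        using ce sub c_star[OF xy(1)] c_star[OF xy(2)] by (metis image_eqI insert_subset empty_subsetI subsetD)
      moreover have "finite (c ` cycle_edges p)" by (simp add: cycle_edges_def)
      \<comment> \<open>At most two colours occur, and \<open>g ?x\<close> and \<open>g ?y\<close>
        are already two.\<close>
      ultimately have im: "c ` cycle_edges p = {g ?x, g ?y}"
        using g(1) card_seteq[of "c ` cycle_edges p" "{g ?x, g ?y}"] by simp
      have nu: "u \<notin> e" if "e \<in> path_edges q" for e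
        using that dq(1) by (auto simp: path_edges_def)
      then have "path_edges q \<subseteq> E0" using ce(1) sub subE by blast
      moreover have "\<phi> ` path_edges q \<subseteq> {g ?x, g ?y}"
      proof
        fix a assume "a \<in> \<phi> ` path_edges q"
        then obtain e where e: "e \<in> path_edges q" "a = c e" using c_E0 nu by auto
        then have "e \<in> cycle_edges p" using ce(1) sub by blast
        then show "a \<in> {g ?x, g ?y}" using e(2) im by blast
      qed
      ultimately have "linked E0 \<phi> {g ?x, g ?y} ?x ?y"
        using dq unfolding linked_def two_colored_path_def by auto
      then show False using g(2) by blast
    qed
  qed
  ultimately show ?thesis by (auto simp: acyclic_edge_coloring_def)
qed

end

text \<open>Induction on the edges: the star of an end \<open>u\<close> of some edge is removed, the
  rest is coloured, and the colouring extends over the star. As \<open>num\<close> only involves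
  \<open>D\<close> and \<open>N\<close>, it serves every step.\<close>

theorem acyclic_edge_coloring_bounded_degree:
  assumes "finite E" "\<And>e. e \<in> E \<Longrightarrow> card e = 2" "\<And>v. vertex_degree E v \<le> Suc D" "1 \<le> D"
    and num: "\<And>m. 1 \<le> m \<Longrightarrow> m \<le> Suc D \<Longrightarrow> (m - 1) * ((5 * D + 1) div 2) < m * (N - D)"
  shows "\<exists>c. acyclic_edge_coloring E N c"
  using assms(1-3)
proof (induction "card E" arbitrary: E rule: less_induct)
  case less
  show ?case
  proof (cases "E = {}")
    case True
    have "\<not> is_cycle {} p" for p :: "'a list"
      by (cases p) (auto simp: is_cycle_def cycle_edges_def)
    then show ?thesis
      using True by (auto simp: acyclic_edge_coloring_def proper_edge_coloring_def edge_coloring_def)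
  next
    case False
    then obtain e where e: "e \<in> E" by blast
    then have "e \<noteq> {}" using less.prems(2) by fastforce
    then obtain u where u: "u \<in> e" by blast
    let ?E0 = "{e \<in> E. u \<notin> e}"
    have "e \<notin> ?E0" using u by simp
    then have "?E0 \<subset> E" using e by (metis (no_types, lifting) mem_Collect_eq psubsetI subsetI)
    then have "card ?E0 < card E" using less.prems(1) psubset_card_mono by blast
    moreover have "vertex_degree ?E0 v \<le> Suc D" for v
    proof -
      have "vertex_degree ?E0 v \<le> vertex_degree E v"
        unfolding vertex_degree_def using less.prems(1) by (intro card_mono) auto
      then show ?thesis using less.prems(3) le_trans by blast
    qed
    ultimately obtain \<phi> where "acyclic_edge_coloring ?E0 N \<phi>"
      using less.hyps[of ?E0] less.prems by auto
    then have "star_extension E u D N \<phi>"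
      using less.prems assms(4) by (simp add: star_extension_def)
    then interpret star_extension E u D N \<phi> .
    show ?thesis using num by (rule acyclic_extension)
  qed
qed

section \<open>The numerical estimate and the theorem\<close>

lemma part_size_bound:
  fixes D N m :: nat
  assumes "1 \<le> D" "3569 * D < 1000 * N + 1000" "1 \<le> m" "m \<le> Suc D"
  shows "(m - 1) * ((5 * D + 1) div 2) < m * (N - D)"
proof -
  let ?K = "(5 * D + 1) div 2"
  have ND: "D < N" using assms by simp
  show ?thesis
  proof (cases "?K \<le> N - D")
    case True
    then have "(m - 1) * ?K \<le> (m - 1) * (N - D)" by (rule mult_le_mono2)
    also have "\<dots> < m * (N - D)" using assms ND by simp
    finally show ?thesis .
  next
    case False
    have "2 * int ?K \<le> 5 * int D + 1" by linarith
    then have "int D * (2 * int ?K) \<le> int D * (5 * int D + 1)" by (intro mult_left_mono) auto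
    \<comment> \<open>By integrality \<open>3569 * D < 1000 * N + 1000\<close> gives
      \<open>2569 * D - 999 \<le> 1000 * (N - D)\<close>. This leads to the claim for
      \<open>m = D + 1\<close>.\<close>
    moreover have "(int D + 1) * (2569 * int D - 999) \<le> (int D + 1) * (1000 * (int N - int D))"
      using assms(2) by (intro mult_left_mono) auto
    moreover have "int D \<le> int D * int D" using assms(1) by simp
    ultimately have "int D * int ?K < (int D + 1) * (int N - int D)"
      using assms(1) unfolding distrib_left distrib_right left_diff_distrib right_diff_distrib
      by linarith
    \<comment> \<open>As \<open>?K\<close> exceeds \<open>N - D\<close>, the left side grows faster
      with \<open>m\<close> than the right, so \<open>m = D + 1\<close> is the worst case; this
      product carries it over to smaller \<open>m\<close>.\<close>
    moreover have "(int D + 1 - int m) * (int ?K - (int N - int D)) \<ge> 0"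
      using assms(4) False by (intro mult_nonneg_nonneg) auto
    ultimately have "(int m - 1) * int ?K < int m * (int N - int D)"
      unfolding distrib_left distrib_right left_diff_distrib right_diff_distrib by linarith
    then have "int ((m - 1) * ?K) < int (m * (N - D))"
      using assms(3) ND by (simp add: of_nat_diff)
    then show ?thesis by (simp only: of_nat_less_iff)
  qed
qed

theorem theorem5p1:
  fixes V :: "'a set" and E :: "'a set set"
  assumes "finite_simple_graph V E"
    and "max_degree V E > 1"
  shows "real (acyclic_chromatic_index E) \<le> 3.569 * (real (max_degree V E) - 1)"
proof -
  define D where "D = max_degree V E - 1"
  \<comment> \<open>The largest integer within the bound. The floor loses less than 1, whence the
    form of the hypothesis in \<open>part_size_bound\<close>.\<close>
  define N where "N = nat \<lfloor>3.569 * real D\<rfloor>"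
  have D: "1 \<le> D" "max_degree V E = Suc D" using assms(2) by (auto simp: D_def)
  have "real N = of_int \<lfloor>3.569 * real D\<rfloor>" by (simp add: N_def)
  then have N: "real N \<le> 3.569 * real D" "3.569 * real D < real N + 1"
    using of_int_floor_le[of "3.569 * real D"] real_of_int_floor_add_one_gt[of "3.569 * real D"]
    by simp_all
  have card2: "card e = 2" "e \<subseteq> V" if "e \<in> E" for e
    using assms(1) that by (auto simp: finite_simple_graph_def)
  have finV: "finite V" using assms(1) by (simp add: finite_simple_graph_def)
  have "vertex_degree E v \<le> Suc D" for v
  proof (cases "v \<in> V")
    case True
    then show ?thesis unfolding D(2)[symmetric] max_degree_def using finV by simp
  next
    case False
    then have *: "{e \<in> E. v \<in> e} = {}" using card2(2) by blast
    show ?thesis unfolding vertex_degree_def * by simp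
  qed
  moreover have "3569 * D < 1000 * N + 1000"
  proof -
    have "real (3569 * D) < real (1000 * N + 1000)" using N(2) by simp
    then show ?thesis by (simp only: of_nat_less_iff)
  qed
  ultimately have "\<exists>c. acyclic_edge_coloring E N c"
    using finite_simple_graph_finite_edges[OF assms(1)] card2(1) D(1) part_size_bound
    by (intro acyclic_edge_coloring_bounded_degree[of E D N]) auto
  then have "acyclic_chromatic_index E \<le> N"
    unfolding acyclic_chromatic_index_def by (rule Least_le)
  then show ?thesis using N(1) D by simp
qed

end
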